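(* Let $p$ be a prime and let $G=\mathbb{Z}(p^\infty)\oplus H$, where $H$ is a countable (finite or infinite) Abelian group. Then for every subgroup $H_1$ of $G$ containing $H$ there is a complete Hausdorff group topology $\tau$ on $G$ such that $\mathbf{n}(G,\tau)=H_1$.
   Context: $\mathbb{Z}(p^\infty)$ is the Prüfer $p$-group. $H$ is identified with the subgroup $\{0\}\oplus H$ of $G$. For a topological Abelian group $X$, $X^\wedge$ is the group of continuous characters (continuous homomorphisms to the circle group), and $\mathbf{n}(X)=\bigcap_{\chi\in X^\wedge}\ker\chi$ is the von Neumann radical of $X$. *)

theory Defs
  imports "HOL-Analysis.Analysis" "HOL-Algebra.Coset" "HOL-Computational_Algebra.Primes"
begin

definition circle_group :: "complex monoid" where
  "circle_group = \<lparr>carrier = sphere 0 1, mult = (*), one = 1\<rparr>"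

text \<open>The Pruefer group \<open>\<int>(p\<^sup>\<infinity>)\<close>, realised multiplicatively as the
  group of all complex roots of unity of \<open>p\<close>-power order.\<close>

definition prufer_group :: "nat \<Rightarrow> complex monoid" where
  "prufer_group p = \<lparr>carrier = {z. \<exists>n. z ^ (p ^ n) = 1}, mult = (*), one = 1\<rparr>"

definition group_topology :: "('a, 'b) monoid_scheme \<Rightarrow> 'a topology \<Rightarrow> bool" where
  "group_topology G T \<longleftrightarrow>
     topspace T = carrier G \<and>
     continuous_map (prod_topology T T) T (\<lambda>(x, y). x \<otimes>\<^bsub>G\<^esub> y) \<and>
     continuous_map T T (\<lambda>x. inv\<^bsub>G\<^esub> x)"

text \<open>Cauchy filters of the left uniformity; for Abelian groups, the only case of interest
  here, it coincides with the right and the two-sided uniformity.\<close>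

definition group_cauchy_filter ::
  "('a, 'b) monoid_scheme \<Rightarrow> 'a topology \<Rightarrow> 'a filter \<Rightarrow> bool" where
  "group_cauchy_filter G T F \<longleftrightarrow>
     F \<noteq> bot \<and> (\<forall>\<^sub>F x in F. x \<in> carrier G) \<and>
     (\<forall>U. openin T U \<and> \<one>\<^bsub>G\<^esub> \<in> U \<longrightarrow>
        (\<forall>\<^sub>F (x, y) in F \<times>\<^sub>F F. inv\<^bsub>G\<^esub> x \<otimes>\<^bsub>G\<^esub> y \<in> U))"

definition complete_group_topology :: "('a, 'b) monoid_scheme \<Rightarrow> 'a topology \<Rightarrow> bool" where
  "complete_group_topology G T \<longleftrightarrow>
     group_topology G T \<and>
     (\<forall>F. group_cauchy_filter G T F \<longrightarrow> (\<exists>l. limitin T (\<lambda>x. x) l F))"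

definition continuous_characters ::
  "('a, 'b) monoid_scheme \<Rightarrow> 'a topology \<Rightarrow> ('a \<Rightarrow> complex) set" where
  "continuous_characters G T =
     {f \<in> hom G circle_group. continuous_map T (top_of_set (carrier circle_group)) f}"

definition von_neumann_radical :: "('a, 'b) monoid_scheme \<Rightarrow> 'a topology \<Rightarrow> 'a set" where
  "von_neumann_radical G T =
     (\<Inter>f \<in> continuous_characters G T. kernel G circle_group f)"

lemma comm_group_circle_group: "comm_group circle_group"
proof (rule comm_groupI)
  fix x assume x: "x \<in> carrier circle_group"
  then have "x \<noteq> 0"
    by (auto simp: circle_group_def)
  with x show "\<exists>y\<in>carrier circle_group. y \<otimes>\<^bsub>circle_group\<^esub> x = \<one>\<^bsub>circle_group\<^esub>"
    by (intro bexI[of _ "inverse x"]) (auto simp: circle_group_def norm_inverse)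
qed (auto simp: circle_group_def norm_mult mult_ac)

lemma comm_group_prufer_group:
  assumes "p > 0"
  shows "comm_group (prufer_group p)"
proof (rule comm_groupI)
  fix x y assume "x \<in> carrier (prufer_group p)" "y \<in> carrier (prufer_group p)"
  then obtain m n where "x ^ (p ^ m) = 1" "y ^ (p ^ n) = 1"
    by (auto simp: prufer_group_def)
  then have "(x ^ (p ^ m)) ^ (p ^ n) = 1" "(y ^ (p ^ n)) ^ (p ^ m) = 1"
    by simp_all
  then have "x ^ (p ^ (m + n)) = 1" "y ^ (p ^ (m + n)) = 1"
    by (simp_all add: power_add mult.commute flip: power_mult)
  then show "x \<otimes>\<^bsub>prufer_group p\<^esub> y \<in> carrier (prufer_group p)"
    by (auto simp: prufer_group_def power_mult_distrib intro!: exI[of _ "m + n"])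
next
  fix x assume x: "x \<in> carrier (prufer_group p)"
  then have "x \<noteq> 0"
    using assms by (auto simp: prufer_group_def power_0_left)
  with x show "\<exists>y\<in>carrier (prufer_group p).
      y \<otimes>\<^bsub>prufer_group p\<^esub> x = \<one>\<^bsub>prufer_group p\<^esub>"
    by (intro bexI[of _ "inverse x"]) (auto simp: prufer_group_def power_inverse)
qed (auto simp: prufer_group_def mult_ac)

end

theory Submission
  imports Defs "HOL-Algebra.FiniteProduct" "HOL-Algebra.Generated_Groups"
begin

text \<open>
  Write \<open>e(x) = exp (2 \<pi> i x)\<close>, which is the function \<open>E\<close> below. The topology is the finest group topology on
  \<open>G = \<int>(p\<^sup>\<infinity>) \<oplus> H\<close> in which two sequences tend to the identity: the standard generators
  \<open>e(p\<^sup>-\<^sup>n)\<close> of the Pruefer group, and words \<open>w\<^sub>n = s\<^sub>n v\<^sub>n\<close>. Here \<open>s\<^sub>n\<close> runs through \<open>H1\<close> and hits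
  every element infinitely often, and \<open>v\<^sub>n\<close> is a product of \<open>n\<close> generators \<open>e(p\<^sup>-\<^sup>i)\<close> whose exponents \<open>i\<close>
  lie far out and are spaced \<open>2n\<close> apart.

  The radical. If a character \<open>\<chi>\<close> satisfies \<open>\<chi>(e(p\<^sup>-\<^sup>n)) \<longlonglongrightarrow> 1\<close>, then the convergence is
  geometric, because each term is the \<open>p\<close>-th power of the next one. Hence \<open>\<chi>(v\<^sub>n) \<longlonglongrightarrow> 1\<close>, however many
  factors \<open>v\<^sub>n\<close> has, and \<open>\<chi>(w\<^sub>n) \<longlonglongrightarrow> 1\<close> says exactly that \<open>\<chi>\<close> is trivial on \<open>H1\<close>
  (\<open>continuous_characters_iff\<close>). The characters \<open>z \<mapsto> z\<^bsup>p^k\<^esup>\<close> of the Pruefer group tend to \<open>1\<close> along the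
  generators, and they separate the elements outside \<open>H1\<close> from \<open>H1\<close> (\<open>separating_character\<close>).

  The Hausdorff property. This is where the length of \<open>v\<^sub>n\<close> matters. By a criterion of Protasov and
  Zelenyuk it suffices that an element \<open>g \<noteq> 1\<close> is not a product of a bounded number \<open>k\<close> of terms
  taken arbitrarily far out in the two sequences. In such a product let \<open>w\<^sub>N\<close> be the last word whose
  total exponent is nonzero. The \<open>N > k\<close> factors of \<open>v\<^sub>N\<close> cannot all be cancelled by at most \<open>k\<close>
  generators: one factor sits in the middle of an interval of exponents that the generators avoid,
  and the size of the remaining terms rules out a relation (\<open>short_relation_no_blocks\<close>). So no words
  remain, and a bounded product of late generators is close to \<open>1\<close> (\<open>short_tail_integer\<close>).

  Completeness. \<open>G\<close> is the union of the sets \<open>K\<^sub>n\<close> of products of \<open>n\<close> terms, and a basic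
  neighbourhood of \<open>1\<close> is a product of tails, one for each natural number. A Cauchy filter without a
  limit is disjoint from some \<open>K\<^sub>n U\<^sub>n\<close> for each \<open>n\<close>; a diagonal choice yields one neighbourhood \<open>U\<close>
  with \<open>U \<subseteq> K\<^sub>r U\<^sub>2\<^sub>r\<close> for all \<open>r\<close>, which contradicts the Cauchy property (\<open>complete_vtop\<close>).
\<close>

section \<open>Characters of Abelian groups\<close>

lemma circle_group_simps [simp]:
  "carrier circle_group = sphere 0 1" "x \<otimes>\<^bsub>circle_group\<^esub> y = x * y" "\<one>\<^bsub>circle_group\<^esub> = 1"
  by (simp_all add: circle_group_def)

context comm_group begin

lemma character_norm: "f \<in> hom G circle_group \<Longrightarrow> x \<in> carrier G \<Longrightarrow> norm (f x) = 1"
  using hom_in_carrier[of f G circle_group x] by auto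

lemma character_mult: 
  "f \<in> hom G circle_group \<Longrightarrow> x \<in> carrier G \<Longrightarrow> y \<in> carrier G \<Longrightarrow> f (x \<otimes> y) = f x * f y"
  using hom_mult[of f G circle_group x y] by simp

lemma character_one:
  assumes "f \<in> hom G circle_group" shows "f \<one> = 1"
proof -
  have "f \<one> \<noteq> 0"
    using character_norm[OF assms, of \<one>] by auto
  moreover have "f \<one> * f \<one> = f \<one>"
    using character_mult[OF assms one_closed one_closed, symmetric] by (simp only: l_one one_closed)
  ultimately show ?thesis by simp
qed

lemma character_inv:
  assumes "f \<in> hom G circle_group" "x \<in> carrier G" shows "f (inv x) = inverse (f x)"
proof -
  have "f x * f (inv x) = f (x \<otimes> inv x)"
    using assms by (intro character_mult[symmetric]) auto
  also have "\<dots> = 1"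
    unfolding r_inv[OF assms(2)] by (rule character_one[OF assms(1)])
  finally show ?thesis by (rule inverse_unique[symmetric])
qed

lemma character_int_pow:
  assumes "f \<in> hom G circle_group" "x \<in> carrier G" 
  shows "f (x [^] (i::int)) = f x powi i"
proof -
  have nat: "f (x [^] (n::nat)) = f x ^ n" for n
  proof (induction n)
    case 0
    then show ?case using character_one[OF assms(1)] by simp
  next
    case (Suc n)
    then show ?case using character_mult[OF assms(1) nat_pow_closed[OF assms(2)] assms(2)] by simp
  qed
  show ?thesis
  proof (cases i rule: int_cases2)
    case (nonneg n)
    then show ?thesis using nat by (simp add: int_pow_int)
  next
    case (nonpos n)
    have "f (inv (x [^] n)) = inverse (f x ^ n)"
      unfolding nat[symmetric] using assms by (intro character_inv) auto
    then show ?thesis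
      using assms(2) by (simp add: nonpos int_pow_neg_int power_int_minus)
  qed
qed

lemma character_finprod:
  assumes "f \<in> hom G circle_group" "finite I" "g \<in> I \<rightarrow> carrier G"
  shows "f (finprod G g I) = (\<Prod>i\<in>I. f (g i))"
  using assms(2,3)
proof (induction I)
  case empty
  then show ?case using character_one[OF assms(1)] by simp
next
  case (insert i I)
  then have "g \<in> I \<rightarrow> carrier G" "g i \<in> carrier G" by auto
  then show ?case using insert character_mult[OF assms(1)] by simp
qed

text \<open>
  A product of unit complex numbers is no further from \<open>1\<close> than its factors are in total. All
  estimates for characters in this file go through this bound.
\<close>

lemma character_finprod_dist:
  assumes "f \<in> hom G circle_group" "finite I" "g \<in> I \<rightarrow> carrier G"
  shows "norm (f (finprod G g I) - 1) \<le> (\<Sum>i\<in>I. norm (f (g i) - 1))"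
proof -
  have "norm ((\<Prod>i\<in>I. f (g i)) - (\<Prod>i\<in>I. 1)) \<le> (\<Sum>i\<in>I. norm (f (g i) - 1))"
    using assms by (intro norm_prod_diff) (auto simp: character_norm Pi_iff)
  then show ?thesis using character_finprod[OF assms] by simp
qed

end

section \<open>The finest group topology with prescribed vanishing sets\<close>

text \<open>
  The set \<open>A n\<close> stands for the tail from \<open>n\<close> on of the sequences that are to converge to the
  identity, together with inverses and \<open>1\<close>. Finiteness of \<open>A m - A n\<close> is what makes the set of all
  terms behave like a convergent sequence with its limit, hence like a compact set; the two
  inductions in \<open>not_in_prods_append\<close> and \<open>complete_vtop\<close> use it in place of compactness.
\<close>

locale vanishing_sets = comm_group G for G (structure) +
  fixes A :: "nat \<Rightarrow> 'a set"
  assumes A_carrier: "A n \<subseteq> carrier G"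
    and one_in_A: "\<one> \<in> A n"
    and inv_in_A: "x \<in> A n \<Longrightarrow> inv x \<in> A n"
    and A_antimono: "m \<le> n \<Longrightarrow> A n \<subseteq> A m"
    and A_cofinite: "finite (A m - A n)"
begin

lemma A_closed: "x \<in> A n \<Longrightarrow> x \<in> carrier G"
  using A_carrier by blast

text \<open>
  The basic neighbourhoods of the identity are the infinite products \<open>A (c 0) A (c 1) A (c 2) \<cdots>\<close>, of
  which only finitely many factors are taken. The factors are indexed by an arbitrary finite set
  \<open>I\<close> rather than an initial segment, so that products can be moved to other index sets.
\<close>

definition nbhd :: "(nat \<Rightarrow> nat) \<Rightarrow> 'a set" where
  "nbhd c = {finprod G f I | f I. finite I \<and> (\<forall>i\<in>I. f i \<in> A (c i))}"

text \<open>
  The product sets \<open>A n\<^sub>1 \<cdots> A n\<^sub>k\<close>. For a constant list they are the bounded products of the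
  Protasov-Zelenyuk criterion and, with all indices \<open>0\<close>, the exhausting sets \<open>K\<^sub>k\<close>.
\<close>

primrec prods :: "nat list \<Rightarrow> 'a set" where
  "prods [] = {\<one>}"
| "prods (n # ns) = {a \<otimes> q | a q. a \<in> A n \<and> q \<in> prods ns}"

lemma nbhdI: "finite I \<Longrightarrow> (\<And>i. i \<in> I \<Longrightarrow> f i \<in> A (c i)) \<Longrightarrow> finprod G f I \<in> nbhd c"
  by (auto simp: nbhd_def)

lemma nbhdE:
  assumes "x \<in> nbhd c"
  obtains f I where "finite I" "\<forall>i\<in>I. f i \<in> A (c i)" "f \<in> I \<rightarrow> carrier G" "x = finprod G f I"
proof -
  obtain f I where f: "finite I" "\<forall>i\<in>I. f i \<in> A (c i)" "x = finprod G f I"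
    using assms unfolding nbhd_def by blast
  show thesis
    using f A_closed by (intro that[of I f]) auto
qed

lemma nbhd_closed: "x \<in> nbhd c \<Longrightarrow> x \<in> carrier G"
  by (elim nbhdE) simp

lemma one_in_nbhd: "\<one> \<in> nbhd c"
  using nbhdI[of "{}" "\<lambda>_. \<one>" c] by simp

lemma nbhd_antimono: "(\<And>i. c i \<le> d i) \<Longrightarrow> nbhd d \<subseteq> nbhd c"
  unfolding nbhd_def using A_antimono by blast

lemma A_subset_nbhd: "A (c 0) \<subseteq> nbhd c"
proof
  fix x assume x: "x \<in> A (c 0)"
  then show "x \<in> nbhd c"
    using nbhdI[of "{0}" "\<lambda>_. x" c] A_closed by simp
qed

lemma inv_in_nbhd: 
  assumes "x \<in> nbhd c" shows "inv x \<in> nbhd c"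
proof -
  obtain f I where f: "finite I" "\<forall>i\<in>I. f i \<in> A (c i)" "f \<in> I \<rightarrow> carrier G" "x = finprod G f I"
    using assms by (rule nbhdE)
  have "x \<otimes> finprod G (\<lambda>i. inv f i) I = finprod G (\<lambda>i. f i \<otimes> inv f i) I"
    unfolding f(4) using f(3) by (subst finprod_multf) auto
  also have "\<dots> = \<one>"
    using f(3) by (intro finprod_one_eqI) (simp add: Pi_iff)
  finally have "inv x = finprod G (\<lambda>i. inv f i) I"
    using f(3,4) inv_equality[of "finprod G (\<lambda>i. inv f i) I" x] by (simp add: m_comm Pi_iff)
  then show ?thesis
    using f inv_in_A by (auto intro!: nbhdI)
qed

text \<open>
  Two products, moved to the even and to the odd indices, form a single product.
\<close>

lemma nbhd_mult:
  assumes "x \<in> nbhd (\<lambda>i. c (2 * i))" "y \<in> nbhd (\<lambda>i. c (2 * i + 1))"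
  shows "x \<otimes> y \<in> nbhd c"
proof -
  obtain f I where f: "finite I" "\<forall>i\<in>I. f i \<in> A (c (2 * i))" "f \<in> I \<rightarrow> carrier G" 
      "x = finprod G f I"
    using assms(1) by (rule nbhdE)
  obtain g J where g: "finite J" "\<forall>i\<in>J. g i \<in> A (c (2 * i + 1))" "g \<in> J \<rightarrow> carrier G" 
      "y = finprod G g J"
    using assms(2) by (rule nbhdE)
  define h where "h = (\<lambda>i::nat. if even i then f (i div 2) else g (i div 2))"
  let ?I = "(\<lambda>i::nat. 2 * i) ` I" and ?J = "(\<lambda>i::nat. 2 * i + 1) ` J"
  have h: "h i \<in> A (c i)" if "i \<in> ?I \<union> ?J" for i
    using that f(2) g(2) by (auto simp: h_def)
  have hc: "h \<in> ?I \<rightarrow> carrier G" "h \<in> ?J \<rightarrow> carrier G"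
    using h A_closed by blast+
  have "finprod G h (?I \<union> ?J) = finprod G h ?I \<otimes> finprod G h ?J"
    using f(1) g(1) hc by (intro finprod_Un_disjoint) (auto, presburger)
  also have "finprod G h ?I = finprod G (\<lambda>i. h (2 * i)) I"
    using hc by (intro finprod_reindex) (auto simp: inj_on_def)
  also have "\<dots> = x"
    by (simp add: h_def f)
  also have "finprod G h ?J = finprod G (\<lambda>i. h (2 * i + 1)) J"
    using hc by (intro finprod_reindex) (auto simp: inj_on_def)
  also have "\<dots> = y"
    by (simp add: h_def g)
  finally show ?thesis
    using nbhdI[of "?I \<union> ?J" h c] h f(1) g(1) by auto
qed

definition halve :: "(nat \<Rightarrow> nat) \<Rightarrow> nat \<Rightarrow> nat" where
  "halve c i = max (c (2 * i)) (c (2 * i + 1))"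

lemma nbhd_halve: "x \<in> nbhd (halve c) \<Longrightarrow> y \<in> nbhd (halve c) \<Longrightarrow> x \<otimes> y \<in> nbhd c"
  by (rule nbhd_mult; rule subsetD[OF nbhd_antimono, rotated]) (auto simp: halve_def)

text \<open>
  An element of a neighbourhood uses finitely many indices; the free indices beyond them hold a
  whole neighbourhood. This is why the basic neighbourhoods are open.
\<close>

lemma nbhd_shift:
  assumes "x \<in> nbhd c"
  obtains d where "\<And>y. y \<in> nbhd d \<Longrightarrow> x \<otimes> y \<in> nbhd c"
proof -
  obtain f I where f: "finite I" "\<forall>i\<in>I. f i \<in> A (c i)" "f \<in> I \<rightarrow> carrier G" "x = finprod G f I"
    using assms by (rule nbhdE)
  obtain n where n: "I \<subseteq> {..<n}"
    using f(1) finite_nat_iff_bounded by blast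
  show thesis
  proof (rule that[of "\<lambda>i. c (i + n)"])
    fix y assume "y \<in> nbhd (\<lambda>i. c (i + n))"
    then obtain g J where g: "finite J" "\<forall>i\<in>J. g i \<in> A (c (i + n))" "g \<in> J \<rightarrow> carrier G" 
      "y = finprod G g J"
      by (rule nbhdE)
    define h where "h = (\<lambda>i. if i < n then f i else g (i - n))"
    let ?J = "(\<lambda>i. i + n) ` J"
    have h: "h i \<in> A (c i)" if "i \<in> I \<union> ?J" for i
      using that f(2) g(2) n by (auto simp: h_def)
    have hc: "h \<in> I \<rightarrow> carrier G" "h \<in> ?J \<rightarrow> carrier G"
      using h A_closed by blast+
    have "finprod G h (I \<union> ?J) = finprod G h I \<otimes> finprod G h ?J"
      using f(1) g(1) hc n by (intro finprod_Un_disjoint) auto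
    also have "finprod G h I = x"
      unfolding f(4) using n f(3) by (intro finprod_cong') (auto simp: h_def)
    also have "finprod G h ?J = finprod G (\<lambda>i. h (i + n)) J"
      using hc by (intro finprod_reindex) (auto simp: inj_on_def)
    also have "\<dots> = y"
      by (simp add: h_def g)
    finally show "x \<otimes> y \<in> nbhd c"
      using nbhdI[of "I \<union> ?J" h c] h f(1) g(1) by auto
  qed
qed

definition vtop :: "'a topology" where
  "vtop = topology (\<lambda>W. W \<subseteq> carrier G \<and> (\<forall>x\<in>W. \<exists>c. \<forall>u\<in>nbhd c. x \<otimes> u \<in> W))"

lemma openin_vtop:
  "openin vtop W \<longleftrightarrow> W \<subseteq> carrier G \<and> (\<forall>x\<in>W. \<exists>c. \<forall>u\<in>nbhd c. x \<otimes> u \<in> W)"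
proof -
  have "istopology (\<lambda>W. W \<subseteq> carrier G \<and> (\<forall>x\<in>W. \<exists>c. \<forall>u\<in>nbhd c. x \<otimes> u \<in> W))"
    unfolding istopology_def
  proof (intro conjI allI impI ballI)
    fix S T x 
    assume S: "S \<subseteq> carrier G \<and> (\<forall>x\<in>S. \<exists>c. \<forall>u\<in>nbhd c. x \<otimes> u \<in> S)"
      and T: "T \<subseteq> carrier G \<and> (\<forall>x\<in>T. \<exists>c. \<forall>u\<in>nbhd c. x \<otimes> u \<in> T)"
      and "x \<in> S \<inter> T"
    then obtain c d where c: "\<forall>u\<in>nbhd c. x \<otimes> u \<in> S" and d: "\<forall>u\<in>nbhd d. x \<otimes> u \<in> T"
      by blast
    have "nbhd (\<lambda>i. max (c i) (d i)) \<subseteq> nbhd c \<inter> nbhd d"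
      by (intro Int_greatest nbhd_antimono) auto
    with c d show "\<exists>c. \<forall>u\<in>nbhd c. x \<otimes> u \<in> S \<inter> T"
      by blast
  next
    fix \<K> x
    assume K: "\<forall>K\<in>\<K>. K \<subseteq> carrier G \<and> (\<forall>x\<in>K. \<exists>c. \<forall>u\<in>nbhd c. x \<otimes> u \<in> K)"
      and "x \<in> \<Union>\<K>"
    then obtain K c where "K \<in> \<K>" "\<forall>u\<in>nbhd c. x \<otimes> u \<in> K" by blast
    then show "\<exists>c. \<forall>u\<in>nbhd c. x \<otimes> u \<in> \<Union>\<K>" by blast
  qed blast+
  then show ?thesis
    by (simp add: vtop_def topology_inverse')
qed

lemma topspace_vtop: "topspace vtop = carrier G"
proof -
  have "openin vtop (carrier G)"
    by (auto simp: openin_vtop nbhd_closed)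
  then show ?thesis
    using openin_vtop by (meson openin_subset openin_topspace subset_antisym)
qed

lemma coset_refl: "x \<in> carrier G \<Longrightarrow> \<exists>u. x = x \<otimes> u \<and> u \<in> nbhd c"
  using one_in_nbhd by (intro exI[of _ \<one>]) simp

lemma openin_vtop_coset:
  assumes "x \<in> carrier G"
  shows "openin vtop {x \<otimes> u | u. u \<in> nbhd c}"
  unfolding openin_vtop
proof (intro conjI ballI)
  show "{x \<otimes> u | u. u \<in> nbhd c} \<subseteq> carrier G"
    using assms nbhd_closed by auto
  fix y assume "y \<in> {x \<otimes> u | u. u \<in> nbhd c}"
  then obtain u where u: "u \<in> nbhd c" "y = x \<otimes> u" by auto
  obtain d where "\<And>z. z \<in> nbhd d \<Longrightarrow> u \<otimes> z \<in> nbhd c"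
    using nbhd_shift[OF u(1)] by blast
  then show "\<exists>d. \<forall>z\<in>nbhd d. y \<otimes> z \<in> {x \<otimes> u | u. u \<in> nbhd c}"
    using u assms nbhd_closed by (intro exI[of _ d]) (auto simp: m_assoc)
qed

lemma group_topology_vtop: "group_topology G vtop"
  unfolding group_topology_def
proof (intro conjI)
  show "topspace vtop = carrier G" by (rule topspace_vtop)
  show "continuous_map (prod_topology vtop vtop) vtop (\<lambda>(x, y). x \<otimes> y)"
    unfolding continuous_map_def
  proof (intro conjI allI impI)
    show "(\<lambda>(x, y). x \<otimes> y) \<in> topspace (prod_topology vtop vtop) \<rightarrow> topspace vtop"
      by (auto simp: topspace_vtop)
    fix W assume W: "openin vtop W"
    show "openin (prod_topology vtop vtop) 
      {z \<in> topspace (prod_topology vtop vtop). (case z of (x, y) \<Rightarrow> x \<otimes> y) \<in> W}"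
      unfolding openin_prod_topology_alt
    proof (intro allI impI)
      fix x y assume "(x, y) \<in> {z \<in> topspace (prod_topology vtop vtop). (case z of (x, y) \<Rightarrow> x \<otimes> y) \<in> W}"
      then have xy: "x \<in> carrier G" "y \<in> carrier G" "x \<otimes> y \<in> W"
        by (auto simp: topspace_vtop)
      then obtain c where c: "\<forall>u\<in>nbhd c. (x \<otimes> y) \<otimes> u \<in> W"
        using W openin_vtop by blast
      define S where "S = (\<lambda>x. {x \<otimes> u | u. u \<in> nbhd (halve c)})"
      have S: "openin vtop (S x)" "openin vtop (S y)"
        unfolding S_def using xy openin_vtop_coset by blast+
      have "x \<in> S x" "y \<in> S y"
        using xy coset_refl by (simp_all add: S_def)
      moreover have "a \<otimes> b \<in> W" if "a \<in> S x" "b \<in> S y" for a b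
      proof -
        from that obtain u v where uv: "a = x \<otimes> u" "b = y \<otimes> v" "u \<in> nbhd (halve c)" "v \<in> nbhd (halve c)"
          by (auto simp: S_def)
        have "a \<otimes> b = (x \<otimes> y) \<otimes> (u \<otimes> v)"
          using xy uv nbhd_closed by (simp add: m_ac)
        then show ?thesis
          using c nbhd_halve uv by simp
      qed
      moreover have "S x \<subseteq> carrier G" "S y \<subseteq> carrier G"
        using S openin_vtop by blast+
      ultimately show "\<exists>U V. openin vtop U \<and> openin vtop V \<and> x \<in> U \<and> y \<in> V \<and>
          U \<times> V \<subseteq> {z \<in> topspace (prod_topology vtop vtop). (case z of (x, y) \<Rightarrow> x \<otimes> y) \<in> W}"
        using S by (intro exI[of _ "S x"] exI[of _ "S y"]) (auto simp: topspace_vtop)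
    qed
  qed
  show "continuous_map vtop vtop (\<lambda>x. inv x)"
    unfolding continuous_map_def
  proof (intro conjI allI impI)
    show "(\<lambda>x. inv x) \<in> topspace vtop \<rightarrow> topspace vtop"
      by (auto simp: topspace_vtop)
    fix W assume W: "openin vtop W"
    show "openin vtop {x \<in> topspace vtop. inv x \<in> W}"
      unfolding openin_vtop topspace_vtop
    proof (intro conjI ballI)
      fix x assume "x \<in> {x \<in> carrier G. inv x \<in> W}"
      then have x: "x \<in> carrier G" "inv x \<in> W" by auto
      then obtain c where c: "\<forall>u\<in>nbhd c. inv x \<otimes> u \<in> W"
        using W openin_vtop by blast
      have "inv (x \<otimes> u) \<in> W" if "u \<in> nbhd c" for u
        using that c x(1) inv_in_nbhd nbhd_closed by (simp add: inv_mult)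
      then show "\<exists>c. \<forall>u\<in>nbhd c. x \<otimes> u \<in> {x \<in> carrier G. inv x \<in> W}"
        using x nbhd_closed by (intro exI[of _ c]) auto
    qed auto
  qed
qed

lemma prods_closed: "x \<in> prods ns \<Longrightarrow> x \<in> carrier G"
  by (induction ns arbitrary: x) (auto simp: A_closed)

lemma prods_ConsI: "a \<in> A n \<Longrightarrow> q \<in> prods ns \<Longrightarrow> a \<otimes> q \<in> prods (n # ns)"
  by auto

lemma prods_append: "x \<in> prods ms \<Longrightarrow> y \<in> prods ns \<Longrightarrow> x \<otimes> y \<in> prods (ms @ ns)"
proof (induction ms arbitrary: x)
  case Nil
  then show ?case using prods_closed by simp
next
  case (Cons m ms)
  then obtain a q where "a \<in> A m" "q \<in> prods ms" "x = a \<otimes> q" by auto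
  with Cons show ?case
    using prods_closed A_closed prods_ConsI[of a m "q \<otimes> y" "ms @ ns"] by (simp add: m_assoc)
qed

lemma one_in_prods: "\<one> \<in> prods ns"
proof (induction ns)
  case (Cons n ns)
  then show ?case using prods_ConsI[OF one_in_A Cons.IH, of n] by simp
qed simp

lemma inv_in_prods: "x \<in> prods ns \<Longrightarrow> inv x \<in> prods ns"
proof (induction ns arbitrary: x)
  case (Cons n ns)
  then obtain a q where "a \<in> A n" "q \<in> prods ns" "x = a \<otimes> q" by auto
  moreover from this have "inv a \<otimes> inv q \<in> prods (n # ns)"
    using Cons.IH inv_in_A by (intro prods_ConsI)
  moreover have "inv x = inv a \<otimes> inv q"
    using calculation A_closed prods_closed by (simp add: inv_mult del: prods.simps)
  ultimately show ?case by simp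
qed simp

lemma subgroup_prods: "subgroup (\<Union>k. prods (replicate k 0)) G"
proof
  show "(\<Union>k. prods (replicate k 0)) \<subseteq> carrier G"
    using prods_closed by blast
  show "\<one> \<in> (\<Union>k. prods (replicate k 0))"
    using one_in_prods by blast
  fix x y assume x: "x \<in> (\<Union>k. prods (replicate k 0))"
  show "inv x \<in> (\<Union>k. prods (replicate k 0))"
    using x inv_in_prods by blast
  assume "y \<in> (\<Union>k. prods (replicate k 0))"
  then obtain j k where "x \<in> prods (replicate j 0)" "y \<in> prods (replicate k 0)"
    using x by blast
  then have "x \<otimes> y \<in> prods (replicate (j + k) 0)"
    by (simp add: prods_append replicate_add)
  then show "x \<otimes> y \<in> (\<Union>k. prods (replicate k 0))" by blast
qed

lemma prods_antimono: "list_all2 (\<le>) ms ns \<Longrightarrow> prods ns \<subseteq> prods ms"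
proof (induction rule: list_all2_induct)
  case (Cons m ms n ns)
  then show ?case using A_antimono[of m n] by (simp, blast)
qed auto

text \<open>
  The list is reversed because \<open>prods\<close> adds the newest factor at the front.
\<close>

lemma finprod_in_prods:
  assumes "I \<subseteq> {..<n}" "\<And>i. i \<in> I \<Longrightarrow> f i \<in> A (c i)"
  shows "finprod G f I \<in> prods (map c (rev [0..<n]))"
  using assms
proof (induction n arbitrary: I)
  case (Suc n)
  have fin: "finite I" using Suc.prems(1) finite_subset by blast
  have IH: "finprod G f (I - {n}) \<in> prods (map c (rev [0..<n]))"
    using Suc.prems by (intro Suc.IH) (auto simp: less_Suc_eq)
  show ?case
  proof (cases "n \<in> I")
    case True
    then have "finprod G f (insert n (I - {n})) = f n \<otimes> finprod G f (I - {n})"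
      using Suc.prems fin A_closed by (intro finprod_insert) auto
    with True IH Suc.prems(2)[of n] show ?thesis
      by (auto simp: insert_absorb)
  next
    case False
    with IH prods_ConsI[OF one_in_A IH] prods_closed[OF IH] show ?thesis
      by simp
  qed
qed auto

text \<open>
  The product set of a list \<open>ns\<close> is closed, even after adding boundedly many late factors: a point
  outside it stays outside. Let \<open>n\<close> be the first index. A first factor \<open>a\<close> that is late itself
  is counted among the late factors, which is why the number \<open>l\<close> must be arbitrary in the
  induction; for each of the finitely many other values of \<open>a\<close> the induction hypothesis applies to
  \<open>a\<^sup>-\<^sup>1 x\<close>.
\<close>

lemma not_in_prods_append:
  assumes crit: "\<And>g k. g \<in> carrier G \<Longrightarrow> g \<noteq> \<one> \<Longrightarrow> \<exists>m. g \<notin> prods (replicate k m)"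
    and "x \<in> carrier G" "x \<notin> prods ns"
  shows "\<exists>m. x \<notin> prods (ns @ replicate l m)"
  using assms(2,3)
proof (induction ns arbitrary: x l)
  case Nil
  then show ?case using crit by simp
next
  case (Cons n ns)
  have step: "inv a \<otimes> x \<in> carrier G" "inv a \<otimes> x \<notin> prods ns" if "a \<in> A n" for a
  proof -
    show "inv a \<otimes> x \<in> carrier G" using Cons.prems that A_closed by simp
    show "inv a \<otimes> x \<notin> prods ns"
    proof
      assume "inv a \<otimes> x \<in> prods ns"
      then have "a \<otimes> (inv a \<otimes> x) \<in> prods (n # ns)" using that by auto
      then show False using Cons.prems that A_closed by (simp flip: m_assoc)
    qed
  qed
  have "x \<notin> prods ns"
    using step[OF one_in_A] Cons.prems by simp
  then obtain m0 where m0: "x \<notin> prods (ns @ replicate (Suc l) m0)"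
    using Cons by blast
  have "\<forall>a\<in>A n - A m0. \<exists>m. inv a \<otimes> x \<notin> prods (ns @ replicate l m)"
    using Cons.IH step by blast
  then obtain \<mu> where \<mu>: "\<And>a. a \<in> A n - A m0 \<Longrightarrow> inv a \<otimes> x \<notin> prods (ns @ replicate l (\<mu> a))"
    by metis
  define M where "M = Max (insert m0 (\<mu> ` (A n - A m0)))"
  have M: "m0 \<le> M" "\<And>a. a \<in> A n - A m0 \<Longrightarrow> \<mu> a \<le> M"
    using A_cofinite[of n m0] by (auto simp: M_def)
  have anti: "prods (ns @ replicate l M) \<subseteq> prods (ns @ replicate l m)" if "m \<le> M" for m
    using that by (intro prods_antimono) (auto simp: list_all2_conv_all_nth nth_append)
  have "x \<notin> prods ((n # ns) @ replicate l M)"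
  proof
    assume "x \<in> prods ((n # ns) @ replicate l M)"
    then obtain a q where aq: "a \<in> A n" "q \<in> prods (ns @ replicate l M)" "x = a \<otimes> q" by auto
    have q: "inv a \<otimes> x = q"
      using aq A_closed prods_closed by (simp flip: m_assoc)
    show False
    proof (cases "a \<in> A m0")
      case True
      have "q \<otimes> a \<in> prods ((ns @ replicate l m0) @ [m0])"
        using aq anti[OF M(1)] True A_closed prods_ConsI[of a m0 \<one> "[]"]
        by (intro prods_append) auto
      then show False
        using m0 aq A_closed prods_closed by (simp add: m_comm replicate_append_same)
    next
      case False
      then show False
        using \<mu>[of a] M(2)[of a] anti[of "\<mu> a"] aq q by auto
    qed
  qed
  then show ?case by blast
qed

lemma prods_swap: "x \<in> prods (ms @ ns) \<longleftrightarrow> x \<in> prods (ns @ ms)"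
proof -
  have split: "\<exists>a b. a \<in> prods ms \<and> b \<in> prods ns \<and> x = a \<otimes> b" if "x \<in> prods (ms @ ns)" for x ms ns
    using that
  proof (induction ms arbitrary: x)
    case Nil
    then show ?case using prods_closed by auto
  next
    case (Cons m ms)
    then obtain a q where "a \<in> A m" "q \<in> prods (ms @ ns)" "x = a \<otimes> q" by auto
    moreover obtain b c where "b \<in> prods ms" "c \<in> prods ns" "q = b \<otimes> c"
      using Cons.IH calculation by blast
    ultimately show ?case
      using A_closed prods_closed by (intro exI[of _ "a \<otimes> b"] exI[of _ c]) (auto simp: m_assoc)
  qed
  have "x \<in> prods (ns @ ms)" if "x \<in> prods (ms @ ns)" for x ms ns
  proof -
    from split[OF that] obtain a b where "a \<in> prods ms" "b \<in> prods ns" "x = a \<otimes> b"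
      by blast
    then show ?thesis
      using prods_append[of b ns a ms] prods_closed m_comm[of a b] by simp
  qed
  then show ?thesis by blast
qed

text \<open>
  The sufficient half of the Protasov-Zelenyuk criterion: choose the tails one after another, each so
  late that \<open>g\<close> remains outside the finite product.
\<close>

lemma not_in_some_nbhd:
  assumes crit: "\<And>g k. g \<in> carrier G \<Longrightarrow> g \<noteq> \<one> \<Longrightarrow> \<exists>m. g \<notin> prods (replicate k m)"
    and g: "g \<in> carrier G" "g \<noteq> \<one>"
  obtains c where "g \<notin> nbhd c"
proof -
  have "\<exists>F. \<forall>n. g \<notin> prods (F n) \<and> (\<exists>m. F (Suc n) = m # F n)"
  proof (rule dependent_nat_choice)
    show "\<exists>x. g \<notin> prods x" using g by (intro exI[of _ "[]"]) simp
    fix ns :: "nat list" assume "g \<notin> prods ns"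
    then obtain m where "g \<notin> prods (ns @ replicate 1 m)"
      using not_in_prods_append[OF crit] g by blast
    then have "g \<notin> prods (m # ns)"
      using prods_swap[of g ns "[m]"] by simp
    then show "\<exists>y. g \<notin> prods y \<and> (\<exists>m. y = m # ns)"
      by blast
  qed
  then obtain F c where F: "\<And>n. g \<notin> prods (F n)" "\<And>n. F (Suc n) = c n # F n"
    by metis
  have Fc: "F n = map c (rev [0..<n]) @ F 0" for n
    by (induction n) (auto simp: F)
  have "prods ns \<subseteq> prods (ns @ F 0)" for ns
  proof
    fix x assume "x \<in> prods ns"
    then show "x \<in> prods (ns @ F 0)"
      using prods_append[OF _ one_in_prods, of x ns "F 0"] prods_closed by simp
  qed
  then have notin: "g \<notin> prods (map c (rev [0..<n]))" for n
    using F(1)[of n] Fc[of n] by auto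
  have "g \<notin> nbhd c"
  proof
    assume "g \<in> nbhd c"
    then obtain f I where f: "finite I" "\<forall>i\<in>I. f i \<in> A (c i)" "f \<in> I \<rightarrow> carrier G" "g = finprod G f I"
      by (rule nbhdE)
    then obtain n where "I \<subseteq> {..<n}"
      using finite_nat_iff_bounded by blast
    then show False
      using finprod_in_prods[of I n f c] f notin by auto
  qed
  then show thesis by (rule that)
qed

lemma Hausdorff_vtop:
  assumes crit: "\<And>g k. g \<in> carrier G \<Longrightarrow> g \<noteq> \<one> \<Longrightarrow> \<exists>m. g \<notin> prods (replicate k m)"
  shows "Hausdorff_space vtop"
  unfolding Hausdorff_space_def topspace_vtop
proof (intro allI impI)
  fix x y assume xy: "x \<in> carrier G \<and> y \<in> carrier G \<and> x \<noteq> y"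
  have "inv x \<otimes> y \<noteq> \<one>"
  proof
    assume "inv x \<otimes> y = \<one>"
    then have "x \<otimes> (inv x \<otimes> y) = x" using xy by simp
    then show False using xy by (simp flip: m_assoc)
  qed
  then obtain c where c: "inv x \<otimes> y \<notin> nbhd c"
    using not_in_some_nbhd[OF crit] xy by (metis inv_closed m_closed)
  define S where "S = (\<lambda>x. {x \<otimes> u | u. u \<in> nbhd (halve c)})"
  have "x \<in> S x" "y \<in> S y"
    using xy coset_refl by (simp_all add: S_def)
  moreover have "openin vtop (S x)" "openin vtop (S y)"
    unfolding S_def using xy openin_vtop_coset by blast+
  moreover have "S x \<inter> S y = {}"
  proof (rule ccontr)
    assume "S x \<inter> S y \<noteq> {}"
    then obtain u v where uv: "u \<in> nbhd (halve c)" "v \<in> nbhd (halve c)" "x \<otimes> u = y \<otimes> v"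
      by (auto simp: S_def)
    then have uv': "u \<in> carrier G" "v \<in> carrier G"
      using nbhd_closed by blast+
    have "inv x \<otimes> y = inv x \<otimes> (y \<otimes> v) \<otimes> inv v"
      using xy uv' by (simp add: m_assoc)
    also have "\<dots> = u \<otimes> inv v"
      using xy uv' by (simp add: m_assoc[symmetric] flip: uv(3))
    also have "\<dots> \<in> nbhd c"
      using uv by (intro nbhd_halve inv_in_nbhd)
    finally show False using c by blast
  qed
  ultimately show "\<exists>U V. openin vtop U \<and> openin vtop V \<and> x \<in> U \<and> y \<in> V \<and> disjnt U V"
    unfolding disjnt_def by blast
qed


lemma finprod_split_prods:
  assumes I: "finite I" and f: "\<forall>i\<in>I. f i \<in> A (c i)"
  obtains q v where "q \<in> prods (replicate n 0)" "v = finprod G f (I - {..<n})" 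
    "finprod G f I = q \<otimes> v"
proof
  have "finprod G f (I \<inter> {..<n}) \<in> prods (map c (rev [0..<n]))"
    using f by (intro finprod_in_prods) auto
  moreover have "prods (map c (rev [0..<n])) \<subseteq> prods (replicate n 0)"
    by (rule prods_antimono) (auto simp: list_all2_conv_all_nth)
  ultimately show "finprod G f (I \<inter> {..<n}) \<in> prods (replicate n 0)" by blast
  have "finprod G f ((I \<inter> {..<n}) \<union> (I - {..<n})) = 
      finprod G f (I \<inter> {..<n}) \<otimes> finprod G f (I - {..<n})"
    using I f A_closed by (intro finprod_Un_disjoint) auto
  moreover have "(I \<inter> {..<n}) \<union> (I - {..<n}) = I" by auto
  ultimately show "finprod G f I = finprod G f (I \<inter> {..<n}) \<otimes> finprod G f (I - {..<n})"
    by simp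
qed simp

text \<open>
  The value \<open>c i\<close> dominates \<open>d n i\<close> for every \<open>n \<le> 2 i\<close>. So in a product of the tails \<open>A (c i)\<close> the
  factors with \<open>i \<ge> r\<close> lie in the neighbourhood of \<open>d (2 r)\<close>, and only the first \<open>r\<close> factors have
  to be absorbed by \<open>K\<^sub>r\<close>. The doubling leaves room for a translation by a second element of \<open>K\<^sub>r\<close>.
\<close>

lemma nbhd_diagonal:
  fixes d :: "nat \<Rightarrow> nat \<Rightarrow> nat"
  obtains c where "\<And>r x. x \<in> nbhd c \<Longrightarrow> 
    \<exists>q v. q \<in> prods (replicate r 0) \<and> v \<in> nbhd (d (r + r)) \<and> x = q \<otimes> v"
proof
  define c where "c = (\<lambda>i. Max ((\<lambda>n. d n i) ` {..2 * i}))"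
  fix r x
  assume "x \<in> nbhd c"
  then obtain f I where f: "finite I" "\<forall>i\<in>I. f i \<in> A (c i)" "f \<in> I \<rightarrow> carrier G" "x = finprod G f I"
    by (rule nbhdE)
  obtain q v where qv: "q \<in> prods (replicate r 0)" "v = finprod G f (I - {..<r})" "x = q \<otimes> v"
    using finprod_split_prods[OF f(1,2), of r] unfolding f(4) by blast
  have "d (r + r) i \<le> c i" if "i \<ge> r" for i
    using that unfolding c_def by (intro Max_ge) auto
  then have "f i \<in> A (d (r + r) i)" if "i \<in> I - {..<r}" for i
    using that f(2) A_antimono[of "d (r + r) i" "c i"] by auto
  then have "v \<in> nbhd (d (r + r))"
    unfolding qv(2) using f(1) by (intro nbhdI) auto
  then show "\<exists>q v. q \<in> prods (replicate r 0) \<and> v \<in> nbhd (d (r + r)) \<and> x = q \<otimes> v"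
    using qv by blast
qed

text \<open>
  Suppose a Cauchy filter \<open>F\<close> has no limit. Then it has no cluster point, so it avoids a
  neighbourhood of each point, and then of each translate of \<open>K\<^sub>n\<close>; this step is a covering
  argument carried out by induction on \<open>n\<close>. The diagonal neighbourhood turns these countably many
  statements into a contradiction: some point \<open>x \<in> K\<^sub>r\<close> is so close to \<open>F\<close> that \<open>F\<close> meets \<open>x K\<^sub>r U\<close>,
  where \<open>U\<close> is the neighbourhood belonging to \<open>K\<^sub>2\<^sub>r\<close>.
\<close>

lemma complete_vtop:
  assumes gen: "carrier G \<subseteq> (\<Union>n. prods (replicate n 0))"
  shows "complete_group_topology G vtop"
  unfolding complete_group_topology_def
proof (intro conjI allI impI group_topology_vtop)
  fix F assume F: "group_cauchy_filter G vtop F"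
  then have carr: "\<forall>\<^sub>F x in F. x \<in> carrier G" and nb: "F \<noteq> bot" 
    by (auto simp: group_cauchy_filter_def)
  have cauchy: "\<exists>P. eventually P F \<and> (\<forall>x y. P x \<longrightarrow> P y \<longrightarrow> x \<in> carrier G \<and> inv x \<otimes> y \<in> nbhd c)" for c
  proof -
    have "openin vtop (nbhd c)"
    proof -
      have "{\<one> \<otimes> u | u. u \<in> nbhd c} = nbhd c"
        using nbhd_closed by force
      then show ?thesis using openin_vtop_coset[of \<one> c] by simp
    qed
    then have "\<forall>\<^sub>F (x, y) in F \<times>\<^sub>F F. inv x \<otimes> y \<in> nbhd c"
      using F one_in_nbhd unfolding group_cauchy_filter_def by blast
    then obtain P Q where PQ: "eventually P F" "eventually Q F" "\<And>x y. P x \<Longrightarrow> Q y \<Longrightarrow> inv x \<otimes> y \<in> nbhd c"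
      unfolding eventually_prod_filter by auto
    then have "eventually (\<lambda>x. P x \<and> Q x \<and> x \<in> carrier G) F"
      using PQ(1,2) carr by (simp add: eventually_conj_iff)
    then show ?thesis using PQ by (intro exI[of _ "\<lambda>x. P x \<and> Q x \<and> x \<in> carrier G"]) auto
  qed
  show "\<exists>l. limitin vtop (\<lambda>x. x) l F"
  proof (rule ccontr)
    assume nolim: "\<nexists>l. limitin vtop (\<lambda>x. x) l F"
    have escape1: "\<exists>c. \<forall>\<^sub>F x in F. \<forall>u\<in>nbhd c. x \<noteq> y \<otimes> u" if y: "y \<in> carrier G" for y
    proof -
      obtain W where W: "openin vtop W" "y \<in> W" "\<not> (\<forall>\<^sub>F x in F. x \<in> W)"
        using nolim[unfolded not_ex, rule_format, of y] y unfolding limitin_def topspace_vtop by auto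
      then obtain c where c: "\<forall>u\<in>nbhd c. y \<otimes> u \<in> W"
        using openin_vtop by blast
      obtain P where P: "eventually P F" 
        "\<And>x z. P x \<Longrightarrow> P z \<Longrightarrow> x \<in> carrier G \<and> inv x \<otimes> z \<in> nbhd (halve c)"
        using cauchy by blast
      have "\<forall>u\<in>nbhd (halve c). x \<noteq> y \<otimes> u" if x: "P x" for x
      proof (intro ballI notI)
        fix u assume u: "u \<in> nbhd (halve c)" "x = y \<otimes> u"
        have "z \<in> W" if z: "P z" for z
        proof -
          have "z = x \<otimes> (inv x \<otimes> z)"
            using P(2)[OF x z] P(2)[OF z z] by (simp flip: m_assoc)
          also have "\<dots> = y \<otimes> (u \<otimes> (inv x \<otimes> z))"
            using P(2)[OF x z] P(2)[OF z z] y u nbhd_closed by (simp add: m_assoc)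
          also have "\<dots> \<in> W"
            using c nbhd_halve[OF u(1)] P(2)[OF x z] by blast
          finally show ?thesis .
        qed
        then have "\<forall>\<^sub>F z in F. z \<in> W"
          by (rule eventually_mono[OF P(1)])
        then show False using W by blast
      qed
      then show ?thesis
        using eventually_mono[OF P(1)] by (intro exI[of _ "halve c"]) simp
    qed
    have escape: "\<exists>c. \<forall>\<^sub>F x in F. \<forall>q\<in>prods (replicate n 0). \<forall>u\<in>nbhd c. x \<noteq> y \<otimes> q \<otimes> u" 
      if "y \<in> carrier G" for y n
      using that
    proof (induction n arbitrary: y)
      case 0
      then show ?case using escape1 by simp
    next
      case (Suc n)
      obtain c where c: "\<forall>\<^sub>F x in F. \<forall>q\<in>prods (replicate n 0). \<forall>u\<in>nbhd c. x \<noteq> y \<otimes> q \<otimes> u"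
        using Suc by blast
      \<comment> \<open>A factor from A m is swallowed by the neighbourhood obtained for the shorter product;
        only finitely many first factors remain, and each of them gets its own neighbourhood.\<close>
      define m where "m = halve c 0"
      have "\<forall>a\<in>A 0 - A m. \<exists>c. \<forall>\<^sub>F x in F. \<forall>q\<in>prods (replicate n 0). \<forall>u\<in>nbhd c. x \<noteq> y \<otimes> a \<otimes> q \<otimes> u"
        using Suc A_closed by blast
      from bchoice[OF this] obtain \<gamma> where \<gamma>: "\<forall>a\<in>A 0 - A m.
          \<forall>\<^sub>F x in F. \<forall>q\<in>prods (replicate n 0). \<forall>u\<in>nbhd (\<gamma> a). x \<noteq> y \<otimes> a \<otimes> q \<otimes> u" ..
      define d where "d = (\<lambda>i. Max (insert (halve c i) ((\<lambda>a. \<gamma> a i) ` (A 0 - A m))))"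
      have d: "nbhd d \<subseteq> nbhd (halve c)" "\<And>a. a \<in> A 0 - A m \<Longrightarrow> nbhd d \<subseteq> nbhd (\<gamma> a)"
        unfolding d_def using A_cofinite[of 0 m] by (intro nbhd_antimono Max_ge; simp)+
      have "\<forall>\<^sub>F x in F. \<forall>a\<in>A 0 - A m. \<forall>q\<in>prods (replicate n 0). \<forall>u\<in>nbhd (\<gamma> a). x \<noteq> y \<otimes> a \<otimes> q \<otimes> u"
        using A_cofinite \<gamma> by (rule eventually_ball_finite)
      with c have "\<forall>\<^sub>F x in F. \<forall>q\<in>prods (replicate (Suc n) 0). \<forall>u\<in>nbhd d. x \<noteq> y \<otimes> q \<otimes> u"
      proof eventually_elim
        case (elim x)
        show ?case
        proof (intro ballI notI)
          fix q u assume "q \<in> prods (replicate (Suc n) 0)" and u: "u \<in> nbhd d" and x: "x = y \<otimes> q \<otimes> u"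
          then obtain a q' where a: "a \<in> A 0" "q' \<in> prods (replicate n 0)" "q = a \<otimes> q'"
            by auto
          have cl: "a \<in> carrier G" "q' \<in> carrier G" "u \<in> carrier G" "y \<in> carrier G"
            using a u Suc.prems A_closed prods_closed nbhd_closed by blast+
          show False
          proof (cases "a \<in> A m")
            case True
            have "a \<otimes> u \<in> nbhd c"
              using True u d(1) A_subset_nbhd[of "halve c"] unfolding m_def by (intro nbhd_halve) auto
            moreover have "x = y \<otimes> q' \<otimes> (a \<otimes> u)"
              unfolding x a(3) using cl by (simp add: m_ac)
            ultimately show False using elim(1) a by blast
          next
            case False
            then have "u \<in> nbhd (\<gamma> a)" using d(2) a u by blast
            moreover have "x = y \<otimes> a \<otimes> q' \<otimes> u"
              unfolding x a(3) using cl by (simp add: m_ac)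
            ultimately show False using elim(2) a False by blast
          qed
        qed
      qed
      then show ?case by blast
    qed
    have "\<exists>c. \<forall>\<^sub>F x in F. \<forall>q\<in>prods (replicate n 0). \<forall>u\<in>nbhd c. x \<noteq> q \<otimes> u" for n
      using escape[OF one_closed, of n] prods_closed by simp
    then have "\<forall>n. \<exists>c. \<forall>\<^sub>F x in F. \<forall>q\<in>prods (replicate n 0). \<forall>u\<in>nbhd c. x \<noteq> q \<otimes> u"
      by (rule allI)
    from choice[OF this] obtain d where 
      d: "\<forall>n. \<forall>\<^sub>F x in F. \<forall>q\<in>prods (replicate n 0). \<forall>u\<in>nbhd (d n). x \<noteq> q \<otimes> u" ..
    obtain c where c: "\<And>r x. x \<in> nbhd c \<Longrightarrow> 
        \<exists>q v. q \<in> prods (replicate r 0) \<and> v \<in> nbhd (d (r + r)) \<and> x = q \<otimes> v"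
      using nbhd_diagonal by blast
    obtain P where P: "eventually P F" 
        "\<And>x z. P x \<Longrightarrow> P z \<Longrightarrow> x \<in> carrier G \<and> inv x \<otimes> z \<in> nbhd c"
      using cauchy by blast
    obtain x where x: "P x"
      using P(1) nb eventually_happens by blast
    then obtain r where r: "x \<in> prods (replicate r 0)"
      using P(2) gen by blast
    have "\<forall>\<^sub>F z in F. False"
      using P(1) d[rule_format, of "r + r"]
    proof eventually_elim
      case (elim z)
      obtain q v where qv: "q \<in> prods (replicate r 0)" "v \<in> nbhd (d (r + r))" "inv x \<otimes> z = q \<otimes> v"
        using c P(2)[OF x elim(1)] by blast
      have "z = x \<otimes> (inv x \<otimes> z)"
        using P(2)[OF x elim(1)] P(2)[OF elim(1) elim(1)] by (simp flip: m_assoc)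
      also have "\<dots> = x \<otimes> q \<otimes> v"
        unfolding qv(3) using P(2)[OF x x] qv prods_closed nbhd_closed by (simp add: m_assoc)
      finally show False
        using elim(2) prods_append[OF r qv(1)] qv(2) by (simp add: replicate_add)
    qed
    then show False using nb by (simp add: trivial_limit_def)
  qed
qed

text \<open>
  The topology does not create further conditions: convergence to \<open>1\<close> along the vanishing sets
  already gives continuity, by choosing the tail with index \<open>i\<close> so late that \<open>f\<close> moves it by less
  than \<open>\<epsilon> / 2\<^bsup>i+2\<^esup>\<close>.
\<close>

lemma continuous_characters_vtop:
  "f \<in> continuous_characters G vtop \<longleftrightarrow>
     f \<in> hom G circle_group \<and> (\<forall>\<epsilon>>0. \<exists>n. \<forall>a\<in>A n. norm (f a - 1) < \<epsilon>)" (is "?L \<longleftrightarrow> ?R")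
proof
  assume L: ?L
  then have hom: "f \<in> hom G circle_group" and cont: "continuous_map vtop euclidean f"
    by (auto simp: continuous_characters_def continuous_map_in_subtopology)
  have f1: "f \<one> = 1"
    using character_finprod_dist[OF hom, of "{}"] by simp
  have "\<exists>n. \<forall>a\<in>A n. norm (f a - 1) < \<epsilon>" if "\<epsilon> > 0" for \<epsilon>
  proof -
    have "openin vtop {x \<in> carrier G. f x \<in> ball 1 \<epsilon>}"
      using openin_continuous_map_preimage[OF cont, of "ball 1 \<epsilon>"] by (simp add: topspace_vtop)
    moreover have "\<one> \<in> {x \<in> carrier G. f x \<in> ball 1 \<epsilon>}"
      using f1 that by simp
    ultimately obtain c where c: "\<forall>u\<in>nbhd c. \<one> \<otimes> u \<in> {x \<in> carrier G. f x \<in> ball 1 \<epsilon>}"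
      using openin_vtop by blast
    have "f a \<in> ball 1 \<epsilon>" if "a \<in> A (c 0)" for a
      using c[rule_format, of a] that A_subset_nbhd[of c] A_closed[OF that] by auto
    then show ?thesis
      by (intro exI[of _ "c 0"]) (simp add: dist_norm norm_minus_commute)
  qed
  with hom show ?R by blast
next
  assume R: ?R
  then have hom: "f \<in> hom G circle_group" by blast
  have small: "\<exists>c. \<forall>u\<in>nbhd c. norm (f u - 1) < \<epsilon>" if \<epsilon>: "\<epsilon> > 0" for \<epsilon>
  proof -
    have "\<forall>i. \<exists>n. \<forall>a\<in>A n. norm (f a - 1) < \<epsilon> / 2 * (1/2) ^ Suc i"
    proof
      fix i
      have "\<epsilon> / 2 * (1/2) ^ Suc i > 0" using \<epsilon> by simp
      then show "\<exists>n. \<forall>a\<in>A n. norm (f a - 1) < \<epsilon> / 2 * (1/2) ^ Suc i" using R by blast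
    qed
    then obtain c where c: "\<And>i a. a \<in> A (c i) \<Longrightarrow> norm (f a - 1) < \<epsilon> / 2 * (1/2) ^ Suc i"
      by metis
    have half: "(\<lambda>i. \<epsilon> / 2 * (1/2) ^ Suc i) sums (\<epsilon> / 2)"
      using sums_mult[OF power_half_series, of "\<epsilon> / 2"] by (simp only: mult_1_right)
    have "norm (f u - 1) < \<epsilon>" if "u \<in> nbhd c" for u
      using that
    proof (rule nbhdE)
      fix g I assume g: "finite I" "\<forall>i\<in>I. g i \<in> A (c i)" "g \<in> I \<rightarrow> carrier G" "u = finprod G g I"
      have "norm (f u - 1) \<le> (\<Sum>i\<in>I. norm (f (g i) - 1))"
        unfolding g(4) using g by (intro character_finprod_dist hom)
      also have "\<dots> \<le> (\<Sum>i\<in>I. \<epsilon> / 2 * (1/2) ^ Suc i)"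
        using c g(2) by (intro sum_mono less_imp_le) auto
      also have "\<dots> \<le> (\<Sum>i. \<epsilon> / 2 * (1/2) ^ Suc i)"
        using \<epsilon> g(1) by (intro sum_le_suminf sums_summable[OF half]) auto
      also have "\<dots> = \<epsilon> / 2"
        using half by (rule sums_unique[symmetric])
      finally show ?thesis using \<epsilon> by simp
    qed
    then show ?thesis by blast
  qed
  have "continuous_map vtop euclidean f"
    unfolding continuous_map_def
  proof (intro conjI allI impI)
    fix V :: "complex set" assume "openin euclidean V"
    then have V: "open V" by simp
    show "openin vtop {x \<in> topspace vtop. f x \<in> V}"
      unfolding openin_vtop topspace_vtop
    proof (intro conjI ballI)
      fix x assume x: "x \<in> {x \<in> carrier G. f x \<in> V}"
      then obtain \<epsilon> where \<epsilon>: "\<epsilon> > 0" "ball (f x) \<epsilon> \<subseteq> V"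
        using V open_contains_ball by blast
      obtain c where c: "\<forall>u\<in>nbhd c. norm (f u - 1) < \<epsilon>"
        using small \<epsilon>(1) by blast
      have "f (x \<otimes> u) \<in> V" if u: "u \<in> nbhd c" for u
      proof -
        have "f (x \<otimes> u) - f x = f x * (f u - 1)"
          using x u nbhd_closed hom_mult[OF hom] by (simp add: algebra_simps)
        then have "norm (f (x \<otimes> u) - f x) = norm (f u - 1)"
          using x hom_in_carrier[OF hom, of x] by (simp add: norm_mult)
        then have "f (x \<otimes> u) \<in> ball (f x) \<epsilon>"
          using c u by (simp add: dist_norm norm_minus_commute)
        then show ?thesis using \<epsilon> by blast
      qed
      then show "\<exists>c. \<forall>u\<in>nbhd c. x \<otimes> u \<in> {x \<in> carrier G. f x \<in> V}"
        using x nbhd_closed by blast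
    qed auto
  qed auto
  moreover have "f \<in> topspace vtop \<rightarrow> sphere 0 1"
    using hom_in_carrier[OF hom] by (auto simp: topspace_vtop)
  ultimately show ?L
    using hom by (auto simp: continuous_characters_def continuous_map_in_subtopology)
qed

end

section \<open>Short relations between inverse powers\<close>

lemma Ints_scaled_inverse_power:
  fixes p :: nat
  assumes "p > 0" "i \<le> j"
  shows "real p ^ j * (1 / real p ^ i) \<in> \<int>"
proof -
  have "real p ^ j * (1 / real p ^ i) = real p ^ (j - i)"
    using assms by (simp add: power_diff)
  then show ?thesis by simp
qed

text \<open>
  The exponent of \<open>v\<^sub>n\<close>, that is, \<open>v\<^sub>n = e(block_sum p n)\<close>. Its terms are the midpoints of \<open>n\<close>
  consecutive intervals of length \<open>2n\<close>, the first of which begins at \<open>n\<^sup>3\<close>; cubes are far enough apart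
  for all these intervals to end before \<open>(n+1)\<^sup>3\<close>.
\<close>

definition block_sum :: "nat \<Rightarrow> nat \<Rightarrow> real" where
  "block_sum p n = (\<Sum>t<n. 1 / real p ^ (n ^ 3 + (2 * t + 1) * n))"

lemma block_exponent_le:
  fixes n N t :: nat
  assumes "n < N" "t < n"
  shows "n ^ 3 + (2 * t + 1) * n \<le> N ^ 3"
proof -
  have "n ^ 3 + (2 * t + 1) * n \<le> n ^ 3 + (2 * n + 1) * n"
    using assms by (intro add_left_mono mult_right_mono) auto
  also have "\<dots> \<le> (n + 1) ^ 3"
    by (simp add: power3_eq_cube algebra_simps)
  also have "\<dots> \<le> N ^ 3"
    using assms by (intro power_mono) auto
  finally show ?thesis .
qed

lemma block_sum_scaled_Ints:
  assumes "p > 0" "n < N" "N ^ 3 \<le> L"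
  shows "real p ^ L * block_sum p n \<in> \<int>"
proof -
  have "real p ^ L * block_sum p n = (\<Sum>t<n. real p ^ L * (1 / real p ^ (n ^ 3 + (2 * t + 1) * n)))"
    by (simp add: block_sum_def sum_distrib_left)
  also have "\<dots> \<in> \<int>"
  proof (intro Ints_sum Ints_scaled_inverse_power)
    fix t assume "t \<in> {..<n}"
    then show "n ^ 3 + (2 * t + 1) * n \<le> L"
      using block_exponent_le[of n N t] assms by auto
  qed (use assms in auto)
  finally show ?thesis .
qed

lemma abs_less_one_Ints: "(x::real) \<in> \<int> \<Longrightarrow> \<bar>x\<bar> < 1 \<Longrightarrow> x = 0"
  using Ints_nonzero_abs_less1 by blast

text \<open>
  Pigeonhole: at most \<open>k\<close> indices \<open>i\<close> have \<open>m i \<noteq> 0\<close>, so they cannot meet \<open>N > k\<close> disjoint intervals.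
\<close>

lemma empty_block:
  fixes m :: "nat \<Rightarrow> int"
  assumes k: "(\<Sum>i<B. \<bar>m i\<bar>) \<le> int k" and N: "k < N"
  obtains t where "t < N" "\<And>i. b + 2 * t * N < i \<Longrightarrow> i \<le> b + 2 * (t + 1) * N \<Longrightarrow> i < B \<Longrightarrow> m i = 0"
proof (rule ccontr)
  assume no: "\<not> thesis"
  have "\<forall>t\<in>{..<N}. \<exists>i. b + 2 * t * N < i \<and> i \<le> b + 2 * (t + 1) * N \<and> i < B \<and> m i \<noteq> 0"
    using no that by blast
  then obtain f where f: "\<And>t. t < N \<Longrightarrow> 
      b + 2 * t * N < f t \<and> f t \<le> b + 2 * (t + 1) * N \<and> f t < B \<and> m (f t) \<noteq> 0"
    by (metis lessThan_iff)
  have lt: "f t < f u" if "t < u" "u < N" for t u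
  proof -
    have "2 * (t + 1) * N \<le> 2 * u * N"
      using that by (intro mult_right_mono) auto
    then show ?thesis
      using f[of t] f[of u] that by linarith
  qed
  have "inj_on f {..<N}"
    by (rule linorder_inj_onI) (use lt in \<open>auto dest: less_imp_neq\<close>)
  then have "N = card (f ` {..<N})"
    by (simp add: card_image)
  also have "\<dots> \<le> card {i. i < B \<and> m i \<noteq> 0}"
    using f by (intro card_mono) auto
  finally have "int N \<le> (\<Sum>i\<in>{i. i < B \<and> m i \<noteq> 0}. 1)"
    by simp
  also have "\<dots> \<le> (\<Sum>i\<in>{i. i < B \<and> m i \<noteq> 0}. \<bar>m i\<bar>)"
    by (intro sum_mono) auto
  also have "\<dots> \<le> (\<Sum>i<B. \<bar>m i\<bar>)"
    by (intro sum_mono2) auto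
  finally show False using k N by simp
qed

text \<open>
  Let \<open>N\<close> be the largest index with \<open>l N \<noteq> 0\<close>, and choose an interval \<open>(L, L + 2 N]\<close> of \<open>v\<^sub>N\<close> that the
  coefficients \<open>m\<close> avoid. Multiplied by \<open>p\<^sup>L\<close>, everything that lies below this interval becomes an
  integer. What is left is \<open>l N / p\<^sup>N\<close> from the midpoint and a remainder from beyond the interval,
  of size at most \<open>k / p\<^sup>2\<^sup>N\<close>. Since \<open>2 k < N < p\<^sup>N\<close>, the sum is nonzero and smaller than \<open>1\<close> in
  absolute value, so it is not an integer.
\<close>

lemma short_relation_no_blocks:
  fixes p k M B :: nat and l m :: "nat \<Rightarrow> int" and a :: "nat \<Rightarrow> real" and \<gamma> :: real
  assumes p: "p \<ge> 2"
    and a: "\<And>n. real p ^ n * a n \<in> \<int>"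
    and short: "(\<Sum>n<B. \<bar>l n\<bar> + \<bar>m n\<bar>) \<le> int k"
    and late: "\<And>n. n < M \<Longrightarrow> l n = 0 \<and> m n = 0"
    and M: "2 * k < M"
    and \<gamma>: "real p ^ M * \<gamma> \<in> \<int>"
    and rel: "(\<Sum>n<B. l n * (a n + block_sum p n) + m n / real p ^ n) - \<gamma> \<in> \<int>"
    and n: "n < B"
  shows "l n = 0"
proof (rule ccontr)
  assume "l n \<noteq> 0"
  define S where "S = {n. n < B \<and> l n \<noteq> 0}"
  have S: "finite S" "S \<noteq> {}"
    using n \<open>l n \<noteq> 0\<close> by (auto simp: S_def)
  define N where "N = Max S"
  have "N \<in> S" unfolding N_def using S by (rule Max_in)
  then have N: "N < B" "l N \<noteq> 0" by (auto simp: S_def)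
  have top: "l i = 0" if "i < B" "i > N" for i
  proof (rule ccontr)
    assume "l i \<noteq> 0"
    then have "i \<in> S" using that by (simp add: S_def)
    then show False using Max_ge[OF S(1)] that by (fastforce simp: N_def)
  qed
  have "M \<le> N" using late[of N] N by (meson not_le)
  define P where "P = real p"
  have P: "P \<ge> 2" using p by (simp add: P_def)
  have "N < 2 ^ N" by (rule less_exp)
  then have "real N < 2 ^ N" by (metis of_nat_less_numeral_power_cancel_iff)
  also have "(2::real) ^ N \<le> P ^ N" using P by (intro power_mono) auto
  finally have NP: "real N < P ^ N" .
  have sums: "(\<Sum>n<B. \<bar>l n\<bar>) + (\<Sum>n<B. \<bar>m n\<bar>) \<le> int k"
    using short by (simp add: sum.distrib)
  have lN: "\<bar>l N\<bar> \<le> (\<Sum>n<B. \<bar>l n\<bar>)"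
    using N by (intro member_le_sum) auto
  have nonneg: "0 \<le> (\<Sum>n<B. \<bar>l n\<bar>)" "0 \<le> (\<Sum>n<B. \<bar>m n\<bar>)"
    by (simp_all add: sum_nonneg)
  have msum: "(\<Sum>n<B. \<bar>m n\<bar>) \<le> int k"
    using sums nonneg by linarith
  obtain t where t: "t < N" 
      "\<And>i. N ^ 3 + 2 * t * N < i \<Longrightarrow> i \<le> N ^ 3 + 2 * (t + 1) * N \<Longrightarrow> i < B \<Longrightarrow> m i = 0"
    using empty_block[OF msum, of N "N ^ 3"] M \<open>M \<le> N\<close> by auto
  define L where "L = N ^ 3 + 2 * t * N"
  have "N ^ 1 \<le> N ^ 3" using t by (intro power_increasing) auto
  then have "N \<le> L" by (simp add: L_def)
  have early: "P ^ L * (1 / P ^ j) \<in> \<int>" if "j \<le> L" for j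
    using that p Ints_scaled_inverse_power by (simp add: P_def)
  have late_term: "P ^ L * (1 / P ^ (L + j)) = 1 / P ^ j" for j
    using P by (simp add: power_add)
  have a': "P ^ L * a i \<in> \<int>" if "i \<le> N" for i
  proof -
    have "P ^ L * a i = P ^ (L - i) * (P ^ i * a i)"
      using that \<open>N \<le> L\<close> by (simp flip: power_add)
    also have "\<dots> \<in> \<int>" using a[of i] by (intro Ints_mult[of "P ^ (L - i)"]) (auto simp: P_def)
    finally show ?thesis .
  qed
  have block_early: "P ^ L * (a i + block_sum p i) \<in> \<int>" if "i < N" for i
  proof -
    have "P ^ L * block_sum p i \<in> \<int>"
      using block_sum_scaled_Ints[of p i N L] that p by (simp add: P_def L_def)
    then show ?thesis using a'[of i] that by (simp add: distrib_left)
  qed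
  \<comment> \<open>The part of the block of N behind the free interval.\<close>
  define R where "R = (\<Sum>u\<in>{t<..<N}. P ^ L * (1 / P ^ (N ^ 3 + (2 * u + 1) * N)))"
  have R: "P ^ L * (a N + block_sum p N) - (1 / P ^ N + R) \<in> \<int>"
  proof -
    have "P ^ L * block_sum p N = (\<Sum>u<N. P ^ L * (1 / P ^ (N ^ 3 + (2 * u + 1) * N)))"
      by (simp add: block_sum_def sum_distrib_left P_def)
    also have "{..<N} = insert t ({..<t} \<union> {t<..<N})"
      using t(1) by auto
    also have "(\<Sum>u\<in>\<dots>. P ^ L * (1 / P ^ (N ^ 3 + (2 * u + 1) * N))) = 
        P ^ L * (1 / P ^ (N ^ 3 + (2 * t + 1) * N)) + 
        (\<Sum>u<t. P ^ L * (1 / P ^ (N ^ 3 + (2 * u + 1) * N))) + R"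
      unfolding R_def by (subst sum.insert, simp, simp, subst sum.union_disjoint) auto
    also have "N ^ 3 + (2 * t + 1) * N = L + N"
      by (simp add: L_def algebra_simps)
    finally have eq: "P ^ L * block_sum p N = 1 / P ^ N + 
        (\<Sum>u<t. P ^ L * (1 / P ^ (N ^ 3 + (2 * u + 1) * N))) + R"
      unfolding late_term .
    have "(\<Sum>u<t. P ^ L * (1 / P ^ (N ^ 3 + (2 * u + 1) * N))) \<in> \<int>"
    proof (intro Ints_sum early)
      fix u assume "u \<in> {..<t}"
      then have "(2 * u + 1) * N \<le> (2 * t) * N" by (intro mult_right_mono) auto
      then show "N ^ 3 + (2 * u + 1) * N \<le> L" by (simp add: L_def)
    qed
    then have "P ^ L * a N + (\<Sum>u<t. P ^ L * (1 / P ^ (N ^ 3 + (2 * u + 1) * N))) \<in> \<int>"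
      using a'[of N] by simp
    then show ?thesis by (simp add: distrib_left eq)
  qed
  have small: "0 \<le> R" "R \<le> 1 / P ^ (2 * N)"
  proof -
    show "0 \<le> R" unfolding R_def using P by (intro sum_nonneg) auto
    have "R \<le> (\<Sum>u\<in>{t<..<N}. 1 / P ^ (3 * N))"
      unfolding R_def
    proof (rule sum_mono)
      fix u assume "u \<in> {t<..<N}"
      then have "(2 * (t + 1) + 1) * N \<le> (2 * u + 1) * N"
        by (intro mult_right_mono) auto
      then have "N ^ 3 + (2 * u + 1) * N = L + ((2 * u + 1) * N - 2 * t * N)" 
        and ge: "3 * N \<le> (2 * u + 1) * N - 2 * t * N"
        by (simp_all add: L_def algebra_simps)
      then show "P ^ L * (1 / P ^ (N ^ 3 + (2 * u + 1) * N)) \<le> 1 / P ^ (3 * N)"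
        using P late_term by (simp add: divide_left_mono power_increasing)
    qed
    also have "\<dots> \<le> real N / P ^ (3 * N)"
      using P by (simp add: divide_right_mono)
    also have "\<dots> \<le> P ^ N / P ^ (3 * N)"
      using NP P by (intro divide_right_mono) auto
    also have "\<dots> = 1 / P ^ (2 * N)"
      using P by (simp add: field_simps flip: power_add)
    finally show "R \<le> 1 / P ^ (2 * N)" .
  qed
  \<comment> \<open>The part of the generators behind the free interval.\<close>
  define T where "T = (\<Sum>i\<in>{L<..<B}. m i * (P ^ L * (1 / P ^ i)))"
  have T: "(\<Sum>i<B. m i * (P ^ L * (1 / P ^ i))) - T \<in> \<int>"
  proof -
    have "(\<Sum>i<B. m i * (P ^ L * (1 / P ^ i))) = (\<Sum>i\<in>{..<B} - {L<..<B}. m i * (P ^ L * (1 / P ^ i))) + T"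
      unfolding T_def by (rule sum.subset_diff) auto
    moreover have "(\<Sum>i\<in>{..<B} - {L<..<B}. m i * (P ^ L * (1 / P ^ i))) \<in> \<int>"
      using early by (intro Ints_sum Ints_mult[OF Ints_of_int]) auto
    ultimately show ?thesis by simp
  qed
  have T_small: "\<bar>T\<bar> \<le> (\<Sum>i<B. \<bar>m i\<bar>) / P ^ (2 * N)"
  proof -
    have "\<bar>T\<bar> \<le> (\<Sum>i\<in>{L<..<B}. \<bar>m i * (P ^ L * (1 / P ^ i))\<bar>)"
      unfolding T_def by (rule sum_abs)
    also have "\<dots> \<le> (\<Sum>i\<in>{L<..<B}. \<bar>m i\<bar> / P ^ (2 * N))"
    proof (rule sum_mono)
      fix i assume i: "i \<in> {L<..<B}"
      show "\<bar>m i * (P ^ L * (1 / P ^ i))\<bar> \<le> \<bar>m i\<bar> / P ^ (2 * N)"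
      proof (cases "i \<le> L + 2 * N")
        case True
        then show ?thesis using t(2)[of i] i by (simp add: L_def algebra_simps)
      next
        case False
        then have "P ^ L * (1 / P ^ i) = 1 / P ^ (i - L)" 
          using late_term[of "i - L"] by simp
        also have "\<dots> \<le> 1 / P ^ (2 * N)"
          using P False by (intro divide_left_mono power_increasing) auto
        finally have "P ^ L * (1 / P ^ i) \<le> 1 / P ^ (2 * N)" .
        then have "\<bar>real_of_int (m i)\<bar> * (P ^ L * (1 / P ^ i)) \<le> \<bar>real_of_int (m i)\<bar> * (1 / P ^ (2 * N))"
          by (intro mult_left_mono) auto
        then show ?thesis using P by (simp add: abs_mult)
      qed
    qed
    also have "\<dots> \<le> (\<Sum>i<B. \<bar>m i\<bar> / P ^ (2 * N))"
      using P by (intro sum_mono2) auto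
    also have "\<dots> = (\<Sum>i<B. \<bar>m i\<bar>) / P ^ (2 * N)"
      by (simp add: sum_divide_distrib)
    finally show ?thesis .
  qed
  define Z where "Z = l N * (1 / P ^ N) + (l N * R + T)"
  have "Z \<in> \<int>"
  proof -
    let ?X = "(\<Sum>i<B. l i * (a i + block_sum p i) + m i / P ^ i)"
    have "P ^ L * (?X - \<gamma>) \<in> \<int>"
      using rel by (intro Ints_mult) (auto simp: P_def)
    moreover have "P ^ (L - M) * (P ^ M * \<gamma>) \<in> \<int>"
      using \<gamma> by (intro Ints_mult[of "P ^ (L - M)"]) (auto simp: P_def)
    then have "P ^ L * \<gamma> \<in> \<int>"
      using \<open>M \<le> N\<close> \<open>N \<le> L\<close> by (simp flip: power_add mult.assoc)
    ultimately have "P ^ L * ?X \<in> \<int>"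
      by (metis Ints_add diff_add_cancel right_diff_distrib)
    also have "P ^ L * ?X = (\<Sum>i<B. l i * (P ^ L * (a i + block_sum p i))) + 
        (\<Sum>i<B. m i * (P ^ L * (1 / P ^ i)))"
      by (simp add: sum_distrib_left sum.distrib algebra_simps)
    also have "(\<Sum>i<B. l i * (P ^ L * (a i + block_sum p i))) = l N * (P ^ L * (a N + block_sum p N)) + 
        (\<Sum>i\<in>{..<B} - {N}. l i * (P ^ L * (a i + block_sum p i)))"
      using N by (intro sum.remove) auto
    finally have X: "l N * (P ^ L * (a N + block_sum p N)) + 
        (\<Sum>i\<in>{..<B} - {N}. l i * (P ^ L * (a i + block_sum p i))) + 
        (\<Sum>i<B. m i * (P ^ L * (1 / P ^ i))) \<in> \<int>" .
    have "(\<Sum>i\<in>{..<B} - {N}. l i * (P ^ L * (a i + block_sum p i))) \<in> \<int>"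
    proof (rule Ints_sum)
      fix i assume "i \<in> {..<B} - {N}"
      then consider "i < N" | "l i = 0" using top[of i] by fastforce
      then show "l i * (P ^ L * (a i + block_sum p i)) \<in> \<int>"
        using block_early[of i] by cases auto
    qed
    with X have X': "l N * (P ^ L * (a N + block_sum p N)) + (\<Sum>i<B. m i * (P ^ L * (1 / P ^ i))) \<in> \<int>"
      by (metis (no_types, lifting) Ints_diff add.commute add.left_commute add_diff_cancel_left')
    have "l N * (P ^ L * (a N + block_sum p N) - (1 / P ^ N + R)) \<in> \<int>"
      using R by simp
    with T have "l N * (P ^ L * (a N + block_sum p N) - (1 / P ^ N + R)) + 
        ((\<Sum>i<B. m i * (P ^ L * (1 / P ^ i))) - T) \<in> \<int>"
      by (rule Ints_add[rotated])
    from Ints_diff[OF X' this] show "Z \<in> \<int>"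
      by (simp add: Z_def algebra_simps)
  qed
  have Plarge: "2 * real k < P ^ N" 
    using NP M \<open>M \<le> N\<close> by linarith
  have "\<bar>l N * R + T\<bar> \<le> \<bar>l N\<bar> * R + \<bar>T\<bar>"
    using small(1) abs_triangle_ineq[of "l N * R" T] by (simp add: abs_mult)
  also have "\<dots> \<le> \<bar>l N\<bar> * (1 / P ^ (2 * N)) + (\<Sum>i<B. \<bar>m i\<bar>) / P ^ (2 * N)"
    using small T_small by (intro add_mono mult_left_mono) auto
  also have "\<dots> = real_of_int (\<bar>l N\<bar> + (\<Sum>i<B. \<bar>m i\<bar>)) / P ^ (2 * N)"
    by (simp add: add_divide_distrib)
  also have "\<dots> \<le> real k / P ^ (2 * N)"
  proof -
    have "\<bar>l N\<bar> + (\<Sum>i<B. \<bar>m i\<bar>) \<le> int k" using sums lN by linarith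
    then have "real_of_int (\<bar>l N\<bar> + (\<Sum>i<B. \<bar>m i\<bar>)) \<le> real k" by linarith
    then show ?thesis using P by (intro divide_right_mono) auto
  qed
  finally have rest: "\<bar>l N * R + T\<bar> \<le> real k / P ^ (2 * N)" .
  have "real k / P ^ (2 * N) = (real k / P ^ N) * (1 / P ^ N)"
    using P by (simp add: mult_2 power_add)
  also have "\<dots> < 1 * (1 / P ^ N)"
    using P Plarge by (intro mult_strict_right_mono) (auto simp: divide_less_eq)
  finally have lt: "real k / P ^ (2 * N) < 1 / P ^ N" by simp
  have "\<bar>l N\<bar> * (1 / P ^ N) \<ge> 1 * (1 / P ^ N)"
  proof (rule mult_right_mono)
    show "1 \<le> real_of_int \<bar>l N\<bar>" using N by linarith
  qed (use P in simp)
  then have "Z \<noteq> 0"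
    using rest lt P unfolding Z_def by (auto simp: abs_mult add_eq_0_iff)
  have kN: "\<bar>l N\<bar> * (1 / P ^ N) \<le> real k * (1 / P ^ N)"
  proof (rule mult_right_mono)
    have "\<bar>l N\<bar> \<le> int k" 
      using lN sums nonneg by linarith
    then show "real_of_int \<bar>l N\<bar> \<le> real k" by linarith
  qed (use P in auto)
  have "\<bar>Z\<bar> \<le> \<bar>l N * (1 / P ^ N)\<bar> + \<bar>l N * R + T\<bar>"
    unfolding Z_def by (rule abs_triangle_ineq)
  also have "\<bar>l N * (1 / P ^ N)\<bar> = \<bar>l N\<bar> * (1 / P ^ N)"
    using P by (simp add: abs_mult)
  also have "\<dots> + \<bar>l N * R + T\<bar> < (real k + 1) / P ^ N"
    using kN rest lt by (simp add: add_divide_distrib)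
  also have "\<dots> \<le> 1"
  proof -
    have "k \<ge> 1" 
      using N lN sums nonneg by linarith
    then show ?thesis using Plarge P by (simp add: divide_le_eq)
  qed
  finally show False
    using abs_less_one_Ints[OF \<open>Z \<in> \<int>\<close>] \<open>Z \<noteq> 0\<close> by blast
qed

text \<open>
  After multiplication by \<open>p\<^sup>q\<close> the sum is an integer that is smaller than \<open>1\<close> in absolute value.
\<close>

lemma short_tail_integer:
  fixes p k M B q :: nat and m :: "nat \<Rightarrow> int" and \<gamma> :: real
  assumes p: "p \<ge> 2"
    and short: "(\<Sum>n<B. \<bar>m n\<bar>) \<le> int k"
    and late: "\<And>n. n < M \<Longrightarrow> m n = 0"
    and M: "q + k \<le> M"
    and \<gamma>: "real p ^ q * \<gamma> \<in> \<int>"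
    and rel: "(\<Sum>n<B. m n / real p ^ n) - \<gamma> \<in> \<int>"
  shows "\<gamma> \<in> \<int>"
proof -
  define P where "P = real p"
  have P: "P \<ge> 2" using p by (simp add: P_def)
  have "k < 2 ^ k" by (rule less_exp)
  then have "real k < 2 ^ k" by (metis of_nat_less_numeral_power_cancel_iff)
  also have "(2::real) ^ k \<le> P ^ k" using P by (intro power_mono) auto
  finally have kP: "real k < P ^ k" .
  let ?X = "\<Sum>n<B. m n / P ^ n"
  have "P ^ q * (?X - \<gamma>) \<in> \<int>"
    using rel by (intro Ints_mult) (auto simp: P_def)
  then have "P ^ q * ?X \<in> \<int>"
    using \<gamma> by (metis Ints_add P_def diff_add_cancel right_diff_distrib)
  moreover have "\<bar>P ^ q * ?X\<bar> < 1"
  proof -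
    have "\<bar>P ^ q * ?X\<bar> \<le> (\<Sum>n<B. \<bar>P ^ q * (m n / P ^ n)\<bar>)"
      unfolding sum_distrib_left by (rule sum_abs)
    also have "\<dots> \<le> (\<Sum>n<B. \<bar>m n\<bar> / P ^ k)"
    proof (rule sum_mono)
      fix n
      show "\<bar>P ^ q * (m n / P ^ n)\<bar> \<le> \<bar>m n\<bar> / P ^ k"
      proof (cases "n < M")
        case False
        have "P ^ q * P ^ k \<le> P ^ n"
          using False M P by (auto simp flip: power_add intro!: power_increasing)
        then have "\<bar>real_of_int (m n)\<bar> * (P ^ q * P ^ k) \<le> \<bar>real_of_int (m n)\<bar> * P ^ n"
          by (intro mult_left_mono) auto
        then show ?thesis
          using P by (simp add: abs_mult field_simps)
      qed (use late in auto)
    qed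
    also have "\<dots> = real_of_int (\<Sum>n<B. \<bar>m n\<bar>) / P ^ k"
      by (simp add: sum_divide_distrib)
    also have "\<dots> \<le> real k / P ^ k"
    proof (rule divide_right_mono)
      show "real_of_int (\<Sum>n<B. \<bar>m n\<bar>) \<le> real k" using short by linarith
    qed (use P in simp)
    also have "\<dots> < 1"
      using kP P by simp
    finally show ?thesis .
  qed
  ultimately have "P ^ q * ?X = 0"
    by (rule abs_less_one_Ints)
  then have "?X = 0" using P by simp
  then have "- \<gamma> \<in> \<int>" using rel by (simp add: P_def)
  then show ?thesis by simp
qed

section \<open>Roots of unity\<close>

text \<open>
  From \<open>y\<^sub>n - 1 = (y\<^sub>n\<^sub>+\<^sub>1 - 1) (1 + y\<^sub>n\<^sub>+\<^sub>1 + \<cdots> + y\<^sub>n\<^sub>+\<^sub>1\<^bsup>p-1\<^esup>)\<close>, where the second factor tends to \<open>p \<ge> 2\<close>: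
  convergence of any speed is geometric here, with ratio \<open>2/3\<close>.
\<close>

lemma summable_dist_one_of_roots:
  fixes y :: "nat \<Rightarrow> complex"
  assumes p: "p \<ge> 2" and root: "\<And>n. y (Suc n) ^ p = y n" and lim: "y \<longlonglongrightarrow> 1"
  shows "summable (\<lambda>n. norm (y n - 1))"
proof -
  have "(\<lambda>n. \<Sum>j<p. y (Suc n) ^ j) \<longlonglongrightarrow> (\<Sum>j<p. 1 ^ j)"
    by (intro tendsto_intros LIMSEQ_Suc lim)
  then have "(\<lambda>n. norm (\<Sum>j<p. y (Suc n) ^ j)) \<longlonglongrightarrow> real p"
    using tendsto_norm by fastforce
  moreover have "real p > 3 / 2" using p by simp
  ultimately have "\<forall>\<^sub>F n in sequentially. 3 / 2 < norm (\<Sum>j<p. y (Suc n) ^ j)"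
    by (rule order_tendstoD)
  then obtain N where N: "\<And>n. n \<ge> N \<Longrightarrow> 3 / 2 < norm (\<Sum>j<p. y (Suc n) ^ j)"
    by (auto simp: eventually_sequentially)
  have "norm (y (Suc n) - 1) \<le> 2 / 3 * norm (y n - 1)" if "n \<ge> N" for n
  proof -
    have "y n - 1 = (y (Suc n) - 1) * (\<Sum>j<p. y (Suc n) ^ j)"
      using root[of n] power_diff_1_eq[of "y (Suc n)" p] by simp
    then have "norm (y n - 1) = norm (y (Suc n) - 1) * norm (\<Sum>j<p. y (Suc n) ^ j)"
      by (simp add: norm_mult)
    also have "\<dots> \<ge> norm (y (Suc n) - 1) * (3 / 2)"
      using N[OF that] by (intro mult_left_mono) auto
    finally show ?thesis by simp
  qed
  then show ?thesis
    by (intro summable_ratio_test[of "2 / 3" N]) auto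
qed

definition E :: "real \<Rightarrow> complex" where "E x = cis (2 * pi * x)"

lemma E_0 [simp]: "E 0 = 1" and norm_E [simp]: "norm (E x) = 1"
  by (simp_all add: E_def)

lemma E_add: "E (x + y) = E x * E y"
  by (simp add: E_def cis_mult distrib_left)

lemma E_diff: "E (x - y) = E x / E y"
  by (simp add: E_def cis_divide right_diff_distrib)

lemma E_powi: "E x powi i = E (of_int i * x)"
  by (simp add: E_def cis_power_int mult_ac)

lemma E_power: "E x ^ n = E (of_nat n * x)"
  unfolding E_def Complex.DeMoivre by (simp add: mult_ac)

lemma E_sum: "E (\<Sum>i\<in>I. f i) = (\<Prod>i\<in>I. E (f i))"
  by (induction I rule: infinite_finite_induct) (simp_all add: E_add)

lemma E_eq_1_iff: "E x = 1 \<longleftrightarrow> x \<in> \<int>"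
proof
  assume "E x = 1"
  then have "cos (2 * pi * x) = 1" by (simp add: E_def complex_eq_iff)
  then obtain n :: int where "2 * pi * x = of_int n * 2 * pi" by (auto simp: cos_one_2pi_int)
  then have "x = n" by simp
  then show "x \<in> \<int>" by simp
next
  assume "x \<in> \<int>"
  then obtain n :: int where "x = n" by (auto elim: Ints_cases)
  then have "2 * pi * x = of_int n * 2 * pi" by simp
  then have "cos (2 * pi * x) = 1" unfolding cos_one_2pi_int by blast
  moreover from this have "sin (2 * pi * x) = 0" by (rule cos_one_sin_zero)
  ultimately show "E x = 1" by (simp add: E_def complex_eq_iff)
qed

lemma E_eq_iff: "E x = E y \<longleftrightarrow> x - y \<in> \<int>"
proof -
  have "E y \<noteq> 0" using norm_E[of y] by (metis norm_zero zero_neq_one)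
  then have "E x = E y \<longleftrightarrow> E (x - y) = 1" by (simp add: E_diff)
  then show ?thesis by (simp add: E_eq_1_iff)
qed

lemma root_of_unity_lift:
  assumes "z ^ N = 1" "N > 0"
  obtains x where "z = E x" "real N * x \<in> \<int>"
proof -
  have "z \<in> (\<lambda>k. cis (2 * pi * real k / real N)) ` {..<N}"
    using Complex.bij_betw_roots_unity[OF assms(2)] assms(1) by (auto simp: bij_betw_def)
  then obtain k where k: "z = E (real k / real N)"
    by (auto simp: E_def)
  show thesis
    using assms(2) by (intro that[OF k]) simp
qed

text \<open>
  With \<open>a = e(r / p\<^sup>j)\<close> the second condition on \<open>a\<close> says that \<open>p\<close> does not divide \<open>r\<close>, so \<open>r\<close> is
  invertible modulo \<open>p\<^sup>j\<close>.
\<close>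

lemma primitive_root_generates:
  fixes a z :: complex
  assumes p: "prime p" and j: "j > 0" and a: "a ^ (p ^ j) = 1" "a ^ (p ^ (j - 1)) \<noteq> 1" 
    and z: "z ^ (p ^ j) = 1"
  obtains i :: int where "z = a powi i"
proof -
  have pos: "p ^ j > 0" using p by (simp add: prime_gt_0_nat)
  obtain x where x: "a = E x" "real (p ^ j) * x \<in> \<int>"
    using root_of_unity_lift[OF a(1) pos] .
  obtain y where y: "z = E y" "real (p ^ j) * y \<in> \<int>"
    using root_of_unity_lift[OF z pos] .
  obtain r :: int where r: "real (p ^ j) * x = r" using x(2) by (auto elim: Ints_cases)
  obtain s :: int where s: "real (p ^ j) * y = s" using y(2) by (auto elim: Ints_cases)
  have "\<not> int p dvd r"
  proof
    assume "int p dvd r"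
    then obtain c where "r = int p * c" by blast
    moreover have "real (p ^ j) = real p * real (p ^ (j - 1))"
      using j by (cases j) auto
    ultimately have "real p * (real (p ^ (j - 1)) * x) = real p * c"
      using r by simp
    then have "real (p ^ (j - 1)) * x = c"
      using p by (simp add: prime_gt_0_nat)
    then show False using a(2) by (simp add: x(1) E_power E_eq_1_iff del: of_nat_power)
  qed
  then have "coprime (int p) r"
    using p by (intro prime_imp_coprime) auto
  then have "gcd r (int p ^ j) = 1"
    by (simp add: coprime_commute flip: coprime_iff_gcd_eq_1)
  then obtain u v where uv: "u * r + v * int p ^ j = 1"
    using bezout_int[of r "int p ^ j"] by auto
  have "real (p ^ j) * (of_int (u * s) * x - y) = real (p ^ j) * of_int (- s * v)"
  proof -
    have "real (p ^ j) * (of_int (u * s) * x - y) = of_int (u * s) * (real (p ^ j) * x) - real (p ^ j) * y"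
      by (simp add: algebra_simps)
    also have "\<dots> = of_int (u * s * r - s)" unfolding r s by simp
    also have "u * s * r - s = s * (u * r - 1)" by (simp add: algebra_simps)
    also have "u * r - 1 = - v * int p ^ j" using uv by (simp add: algebra_simps)
    finally show ?thesis by simp
  qed
  then have "of_int (u * s) * x - y = of_int (- s * v)"
    using pos mult_left_cancel[of "real (p ^ j)"] by (metis less_numeral_extra(3) of_nat_0_less_iff)
  then have "of_int (u * s) * x - y \<in> \<int>" by (metis Ints_of_int)
  then have "E y = E (of_int (u * s) * x)"
    by (metis E_eq_iff)
  then show thesis
    by (intro that[of "u * s"]) (simp add: x(1) y(1) E_powi)
qed

section \<open>The topology on the sum of the Pruefer group and H\<close>

lemma prufer_group_simps [simp]:
  "x \<otimes>\<^bsub>prufer_group p\<^esub> y = x * y" "\<one>\<^bsub>prufer_group p\<^esub> = 1"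
  "z \<in> carrier (prufer_group p) \<longleftrightarrow> (\<exists>n. z ^ (p ^ n) = 1)"
  by (simp_all add: prufer_group_def)

text \<open>
  The sequence \<open>s\<close> enumerates \<open>H1\<close> with infinite repetition, slowly enough that the Pruefer component
  of \<open>s n\<close> has order dividing \<open>p\<^sup>n\<close>. It therefore does not interfere with \<open>v\<^sub>n\<close>, whose exponents
  start beyond \<open>n\<^sup>3\<close>.
\<close>

locale prufer_sum =
  fixes p :: nat and H :: "('a, 'b) monoid_scheme" and H1 :: "(complex \<times> 'a) set"
    and s :: "nat \<Rightarrow> complex \<times> 'a"
  assumes prime: "prime p"
    and comm_group_H: "comm_group H"
    and subgroup_H1: "subgroup H1 (prufer_group p \<times>\<times> H)"
    and H_subset: "{1} \<times> carrier H \<subseteq> H1"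
    and s_mem: "s n \<in> H1"
    and s_order: "fst (s n) ^ (p ^ n) = 1"
    and s_often: "h \<in> H1 \<Longrightarrow> \<exists>n\<ge>N. s n = h"
begin

abbreviation G where "G \<equiv> prufer_group p \<times>\<times> H"

lemma p_ge_2: "p \<ge> 2" and p_pos: "p > 0"
  using prime prime_ge_2_nat prime_gt_0_nat by auto

interpretation H: comm_group H by (rule comm_group_H)
interpretation P: comm_group "prufer_group p" by (rule comm_group_prufer_group[OF p_pos])

sublocale comm_group G
proof (rule group.group_comm_groupI)
  show "group G" using DirProd_group P.is_group H.is_group by blast
qed (auto simp: mult_DirProd' H.m_comm)

text \<open>
  The first projection is itself a character, so powers and products in its image can be computed
  by the rules for characters.
\<close>

lemma fst_hom: "fst \<in> hom G circle_group"
proof -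
  have "norm z = 1" if "z ^ (p ^ n) = 1" for z :: complex and n
  proof -
    have "norm z ^ (p ^ n) = 1 ^ (p ^ n)" using arg_cong[OF that, of norm] by (simp add: norm_power)
    then show ?thesis by (rule power_eq_imp_eq_base) (use p_pos in auto)
  qed
  then show ?thesis by (auto simp: hom_def)
qed

lemma snd_hom: "snd \<in> hom G H"
  by (auto simp: hom_def)

lemma snd_int_pow: "x \<in> carrier G \<Longrightarrow> snd (x [^]\<^bsub>G\<^esub> (i::int)) = snd x [^]\<^bsub>H\<^esub> i"
  using hom_int_pow[OF snd_hom] is_group H.is_group by blast

lemma snd_finprod_one:
  assumes "finite I" "\<And>i. i \<in> I \<Longrightarrow> F i \<in> carrier G \<and> snd (F i) = \<one>\<^bsub>H\<^esub>"
  shows "snd (finprod G F I) = \<one>\<^bsub>H\<^esub>"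
  using assms
proof (induction I)
  case (insert i I)
  then have "F \<in> I \<rightarrow> carrier G" "F i \<in> carrier G" by blast+
  with insert show ?case by (simp add: mult_DirProd')
qed simp

definition unit_root :: "nat \<Rightarrow> complex \<times> 'a" where
  "unit_root n = (E (1 / real p ^ n), \<one>\<^bsub>H\<^esub>)"

definition block :: "nat \<Rightarrow> complex \<times> 'a" where
  "block n = (E (block_sum p n), \<one>\<^bsub>H\<^esub>)"

definition null_word :: "nat \<Rightarrow> complex \<times> 'a" where
  "null_word n = s n \<otimes>\<^bsub>G\<^esub> block n"

text \<open>
  The bound \<open>1\<close> on the exponents allows only \<open>1\<close>, the two sequences, and their inverses; writing all
  five cases as one product saves case distinctions.
\<close>

definition A :: "nat \<Rightarrow> (complex \<times> 'a) set" where
  "A m = {null_word n [^]\<^bsub>G\<^esub> i \<otimes>\<^bsub>G\<^esub> unit_root n [^]\<^bsub>G\<^esub> j | n i j. m \<le> n \<and> \<bar>i\<bar> + \<bar>j\<bar> \<le> (1::int)}"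

lemma E_in_prufer: "real p ^ n * x \<in> \<int> \<Longrightarrow> (E x, \<one>\<^bsub>H\<^esub>) \<in> carrier G"
  by (auto simp: E_power E_eq_1_iff intro!: exI[of _ n])

lemma unit_root_closed: "unit_root n \<in> carrier G"
  unfolding unit_root_def using p_pos by (intro E_in_prufer[of n]) simp

lemma block_scaled: "real p ^ (Suc n ^ 3) * block_sum p n \<in> \<int>"
  by (rule block_sum_scaled_Ints[of p n "Suc n"]) (use p_pos in auto)

lemma block_closed: "block n \<in> carrier G"
  unfolding block_def by (rule E_in_prufer[OF block_scaled])

lemma H1_closed: "h \<in> H1 \<Longrightarrow> h \<in> carrier G"
  using subgroup.subset[OF subgroup_H1] by blast

lemma null_word_closed: "null_word n \<in> carrier G"
  unfolding null_word_def using H1_closed[OF s_mem] block_closed by (rule m_closed)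

lemma s_eq: "s n = null_word n \<otimes>\<^bsub>G\<^esub> inv\<^bsub>G\<^esub> block n"
  using H1_closed[OF s_mem[of n]] block_closed[of n] by (simp add: null_word_def m_assoc del: carrier_DirProd one_DirProd)

lemma unit_root_power:
  assumes "real p ^ n * x \<in> \<int>"
  obtains i :: int where "(E x, \<one>\<^bsub>H\<^esub>) = unit_root n [^]\<^bsub>G\<^esub> i"
proof -
  obtain i :: int where i: "real p ^ n * x = i" using assms by (auto elim: Ints_cases)
  then have "x = of_int i * (1 / real p ^ n)"
    using p_pos by (simp add: field_simps)
  then have "fst (unit_root n [^]\<^bsub>G\<^esub> i) = E x"
    using character_int_pow[OF fst_hom unit_root_closed] by (simp add: unit_root_def E_powi)
  moreover have "snd (unit_root n [^]\<^bsub>G\<^esub> i) = \<one>\<^bsub>H\<^esub>"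
    using snd_int_pow[OF unit_root_closed] by (simp add: unit_root_def)
  ultimately show thesis
    by (intro that[of i]) (simp add: prod_eq_iff)
qed

lemma block_eq_finprod: 
  "block n = finprod G (\<lambda>t. unit_root (n ^ 3 + (2 * t + 1) * n)) {..<n}"
proof (rule prod_eqI)
  have "fst (finprod G (\<lambda>t. unit_root (n ^ 3 + (2 * t + 1) * n)) {..<n}) = 
      (\<Prod>t<n. fst (unit_root (n ^ 3 + (2 * t + 1) * n)))"
    using unit_root_closed by (intro character_finprod fst_hom) auto
  then show "fst (block n) = fst (finprod G (\<lambda>t. unit_root (n ^ 3 + (2 * t + 1) * n)) {..<n})"
    by (simp add: block_def block_sum_def E_sum unit_root_def)
  have "snd (finprod G (\<lambda>t. unit_root (n ^ 3 + (2 * t + 1) * n)) {..<n}) = \<one>\<^bsub>H\<^esub>"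
    using unit_root_closed by (intro snd_finprod_one) (auto simp: unit_root_def)
  then show "snd (block n) = snd (finprod G (\<lambda>t. unit_root (n ^ 3 + (2 * t + 1) * n)) {..<n})"
    by (simp add: block_def)
qed

lemma A_memI: "m \<le> n \<Longrightarrow> \<bar>i\<bar> + \<bar>j\<bar> \<le> (1::int) \<Longrightarrow> null_word n [^]\<^bsub>G\<^esub> i \<otimes>\<^bsub>G\<^esub> unit_root n [^]\<^bsub>G\<^esub> j \<in> A m"
  unfolding A_def by blast

sublocale vanishing_sets G A
proof
  note cl = null_word_closed unit_root_closed
  note [simp del] = carrier_DirProd
  fix m n x
  show "A n \<subseteq> carrier G"
    using cl by (auto simp: A_def)
  show "\<one>\<^bsub>G\<^esub> \<in> A n"
    using A_memI[of n n 0 0] by (simp del: one_DirProd)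
  show "m \<le> n \<Longrightarrow> A n \<subseteq> A m"
    unfolding A_def using order_trans by blast
  show "inv\<^bsub>G\<^esub> x \<in> A n" if xA: "x \<in> A n"
  proof -
    obtain r i j where x: "x = null_word r [^]\<^bsub>G\<^esub> i \<otimes>\<^bsub>G\<^esub> unit_root r [^]\<^bsub>G\<^esub> j" "n \<le> r" "\<bar>i\<bar> + \<bar>j\<bar> \<le> (1::int)"
      using xA by (auto simp: A_def)
    have "inv\<^bsub>G\<^esub> x = null_word r [^]\<^bsub>G\<^esub> (- i) \<otimes>\<^bsub>G\<^esub> unit_root r [^]\<^bsub>G\<^esub> (- j)"
      using cl by (simp add: x(1) inv_mult int_pow_neg)
    then show ?thesis using A_memI[of n r "- i" "- j"] x by simp
  qed
  let ?F = "(\<lambda>(r, i, j). null_word r [^]\<^bsub>G\<^esub> i \<otimes>\<^bsub>G\<^esub> unit_root r [^]\<^bsub>G\<^esub> j) ` ({..<n} \<times> {-1..1::int} \<times> {-1..1::int})"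
  have "A m - A n \<subseteq> ?F"
  proof
    fix x assume x: "x \<in> A m - A n"
    then obtain r i j where r: "x = null_word r [^]\<^bsub>G\<^esub> i \<otimes>\<^bsub>G\<^esub> unit_root r [^]\<^bsub>G\<^esub> j" "m \<le> r" "\<bar>i\<bar> + \<bar>j\<bar> \<le> (1::int)"
      by (auto simp: A_def)
    then have "r < n" using A_memI[of n r i j] x by force
    moreover have "i \<in> {-1..1}" "j \<in> {-1..1}" using r(3) by auto
    ultimately show "x \<in> ?F" using r(1) by force
  qed
  then show "finite (A m - A n)" by (rule finite_subset) simp
qed

text \<open>
  Collecting equal terms. Unlike the factors of the product, the exponents \<open>l n\<close> and \<open>j n\<close> take
  cancellation into account, so that the last index with \<open>l n \<noteq> 0\<close> is meaningful.
\<close>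

lemma prods_coefficients:
  assumes "x \<in> prods (replicate k m)"
  shows "\<exists>l j B. (\<forall>n. l n \<noteq> 0 \<or> j n \<noteq> 0 \<longrightarrow> m \<le> n \<and> n < B) \<and> (\<Sum>n<B. \<bar>l n\<bar> + \<bar>j n\<bar>) \<le> int k \<and>
    x = finprod G (\<lambda>n. null_word n [^]\<^bsub>G\<^esub> (l n :: int) \<otimes>\<^bsub>G\<^esub> unit_root n [^]\<^bsub>G\<^esub> (j n :: int)) {..<B}"
  using assms
proof (induction k arbitrary: x)
  case 0
  then show ?case by (intro exI[of _ "\<lambda>_. 0"] exI[of _ 0]) auto
next
  note [simp del] = carrier_DirProd one_DirProd
  note [simp] = null_word_closed unit_root_closed
  case (Suc k)
  then obtain a q where aq: "a \<in> A m" "q \<in> prods (replicate k m)" "x = a \<otimes>\<^bsub>G\<^esub> q" by auto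
  obtain r i i' where a: "a = null_word r [^]\<^bsub>G\<^esub> i \<otimes>\<^bsub>G\<^esub> unit_root r [^]\<^bsub>G\<^esub> i'" "m \<le> r" "\<bar>i\<bar> + \<bar>i'\<bar> \<le> (1::int)"
    using aq(1) by (auto simp: A_def)
  obtain l j B where supp: "\<And>n. l n \<noteq> 0 \<or> j n \<noteq> 0 \<Longrightarrow> m \<le> n \<and> n < B" 
    and short: "(\<Sum>n<B. \<bar>l n\<bar> + \<bar>j n\<bar>) \<le> int k"
    and q: "q = finprod G (\<lambda>n. null_word n [^]\<^bsub>G\<^esub> (l n :: int) \<otimes>\<^bsub>G\<^esub> unit_root n [^]\<^bsub>G\<^esub> (j n :: int)) {..<B}"
    using Suc.IH[OF aq(2)] by blast
  define l' where "l' = (\<lambda>n. l n + (if n = r then i else 0))"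
  define j' where "j' = (\<lambda>n. j n + (if n = r then i' else 0))"
  define B' where "B' = max B (Suc r)"
  define F where "F = (\<lambda>l j n. null_word n [^]\<^bsub>G\<^esub> (l n :: int) \<otimes>\<^bsub>G\<^esub> unit_root n [^]\<^bsub>G\<^esub> (j n :: int))"
  have F_closed: "F l j n \<in> carrier G" for l j n by (simp add: F_def)
  have zero: "l n = 0" "j n = 0" if "n \<ge> B" for n using supp[of n] that by force+
  have "finprod G (F l' j') {..<B'} = finprod G (\<lambda>n. F l j n \<otimes>\<^bsub>G\<^esub> (if n = r then a else \<one>\<^bsub>G\<^esub>)) {..<B'}"
    using F_closed aq(1) A_closed
    by (intro finprod_cong') (auto simp: F_def l'_def j'_def a(1) int_pow_mult m_ac)
  also have "\<dots> = finprod G (F l j) {..<B'} \<otimes>\<^bsub>G\<^esub> finprod G (\<lambda>n. if n = r then a else \<one>\<^bsub>G\<^esub>) {..<B'}"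
    using F_closed A_closed[OF aq(1)] by (intro finprod_multf) auto
  also have "finprod G (\<lambda>n. if n = r then a else \<one>\<^bsub>G\<^esub>) {..<B'} = a"
    using finprod_singleton_swap[of r "{..<B'}" "\<lambda>_. a"] A_closed[OF aq(1)] by (simp add: B'_def)
  also have "finprod G (F l j) {..<B'} = finprod G (F l j) {..<B}"
    using F_closed zero by (intro finprod_mono_neutral_cong_right) (auto simp: B'_def F_def)
  also have "\<dots> = q" by (simp add: q F_def)
  finally have "x = finprod G (F l' j') {..<B'}"
    using aq A_closed prods_closed by (simp add: m_comm)
  moreover have "m \<le> n \<and> n < B'" if "l' n \<noteq> 0 \<or> j' n \<noteq> 0" for n
    using that supp[of n] a(2) by (auto simp: l'_def j'_def B'_def split: if_splits)
  moreover have "(\<Sum>n<B'. \<bar>l' n\<bar> + \<bar>j' n\<bar>) \<le> int (Suc k)"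
  proof -
    have "(\<Sum>n<B'. \<bar>l' n\<bar> + \<bar>j' n\<bar>) \<le> 
        (\<Sum>n<B'. (\<bar>l n\<bar> + \<bar>j n\<bar>) + (if n = r then \<bar>i\<bar> + \<bar>i'\<bar> else 0))"
      by (intro sum_mono) (auto simp: l'_def j'_def)
    also have "\<dots> = (\<Sum>n<B'. \<bar>l n\<bar> + \<bar>j n\<bar>) + (\<bar>i\<bar> + \<bar>i'\<bar>)"
      by (simp add: sum.distrib B'_def)
    also have "(\<Sum>n<B'. \<bar>l n\<bar> + \<bar>j n\<bar>) = (\<Sum>n<B. \<bar>l n\<bar> + \<bar>j n\<bar>)"
      using zero by (intro sum.mono_neutral_right) (auto simp: B'_def)
    finally show ?thesis using short a(3) by simp
  qed
  ultimately show ?case unfolding F_def by blast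
qed

text \<open>
  If \<open>g\<close> is a product of \<open>k\<close> late terms, then no words occur in it after cancellation. So its second
  component is trivial, and its first one is a short product of late generators, hence too close to
  \<open>1\<close> to be a nontrivial element of the order of \<open>g\<close>.
\<close>

lemma not_in_some_power:
  assumes g: "g \<in> carrier G" "g \<noteq> \<one>\<^bsub>G\<^esub>"
  shows "\<exists>m. g \<notin> prods (replicate k m)"
proof -
  have "\<forall>n. \<exists>x. fst (s n) = E x \<and> real p ^ n * x \<in> \<int>"
    using root_of_unity_lift[OF s_order] p_pos by (metis of_nat_power zero_less_power)
  then obtain a where a: "\<And>n. fst (s n) = E (a n)" "\<And>n. real p ^ n * a n \<in> \<int>"
    by metis
  obtain q where "fst g ^ (p ^ q) = 1" using g(1) by auto
  then obtain \<gamma> where \<gamma>: "fst g = E \<gamma>" "real p ^ q * \<gamma> \<in> \<int>"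
    using root_of_unity_lift[of "fst g" "p ^ q"] p_pos by (metis of_nat_power zero_less_power)
  define M where "M = 2 * k + 1 + q"
  have M\<gamma>: "real p ^ M * \<gamma> \<in> \<int>"
  proof -
    have "real p ^ M * \<gamma> = real p ^ (2 * k + 1) * (real p ^ q * \<gamma>)"
      by (simp add: M_def power_add)
    moreover have "real p ^ (2 * k + 1) * (real p ^ q * \<gamma>) \<in> \<int>"
      using \<gamma>(2) by (intro Ints_mult[of "real p ^ (2 * k + 1)"]) auto
    ultimately show ?thesis by (simp only:)
  qed
  have "g \<notin> prods (replicate k M)"
  proof
    assume "g \<in> prods (replicate k M)"
    then obtain l j B where supp: "\<And>n. l n \<noteq> 0 \<or> j n \<noteq> 0 \<Longrightarrow> M \<le> n \<and> n < B" 
      and short: "(\<Sum>n<B. \<bar>l n\<bar> + \<bar>j n\<bar>) \<le> int k"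
      and geq: "g = finprod G (\<lambda>n. null_word n [^]\<^bsub>G\<^esub> (l n :: int) \<otimes>\<^bsub>G\<^esub> unit_root n [^]\<^bsub>G\<^esub> (j n :: int)) {..<B}"
      using prods_coefficients by blast
    have late: "l n = 0 \<and> j n = 0" if "n < M" for n
      using supp[of n] that by force
    have Fcl: "null_word n [^]\<^bsub>G\<^esub> l n \<otimes>\<^bsub>G\<^esub> unit_root n [^]\<^bsub>G\<^esub> j n \<in> carrier G" for n
      using null_word_closed unit_root_closed by (simp del: carrier_DirProd)
    have fst_word: "fst (null_word n) = E (a n + block_sum p n)" for n
      by (simp add: null_word_def mult_DirProd' a(1) block_def E_add)
    have "fst (null_word n [^]\<^bsub>G\<^esub> l n \<otimes>\<^bsub>G\<^esub> unit_root n [^]\<^bsub>G\<^esub> j n) = 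
        E (l n * (a n + block_sum p n) + j n / real p ^ n)" for n
      using null_word_closed unit_root_closed fst_hom
      by (simp add: character_mult character_int_pow fst_word E_powi unit_root_def flip: E_add del: carrier_DirProd)
    then have "E \<gamma> = E (\<Sum>n<B. l n * (a n + block_sum p n) + j n / real p ^ n)"
      using character_finprod[OF fst_hom, of "{..<B}"] Fcl by (simp add: geq E_sum flip: \<gamma>(1) del: carrier_DirProd)
    then have rel: "(\<Sum>n<B. l n * (a n + block_sum p n) + j n / real p ^ n) - \<gamma> \<in> \<int>"
      by (metis E_eq_iff)
    have l0: "l n = 0" if "n < B" for n
      by (rule short_relation_no_blocks[OF p_ge_2 a(2) short late _ M\<gamma> rel that]) (simp_all add: M_def)
    have "snd g = \<one>\<^bsub>H\<^esub>"
      unfolding geq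
    proof (rule snd_finprod_one)
      fix n assume "n \<in> {..<B}"
      then have "snd (null_word n [^]\<^bsub>G\<^esub> l n \<otimes>\<^bsub>G\<^esub> unit_root n [^]\<^bsub>G\<^esub> j n) = \<one>\<^bsub>H\<^esub>"
        using l0[of n] snd_int_pow[OF unit_root_closed] by (simp add: mult_DirProd' unit_root_def)
      with Fcl show "null_word n [^]\<^bsub>G\<^esub> l n \<otimes>\<^bsub>G\<^esub> unit_root n [^]\<^bsub>G\<^esub> j n \<in> carrier G \<and>
          snd (null_word n [^]\<^bsub>G\<^esub> l n \<otimes>\<^bsub>G\<^esub> unit_root n [^]\<^bsub>G\<^esub> j n) = \<one>\<^bsub>H\<^esub>" by blast
    qed simp
    moreover have "fst g = 1"
    proof -
      have "(\<Sum>n<B. \<bar>j n\<bar>) \<le> (\<Sum>n<B. \<bar>l n\<bar> + \<bar>j n\<bar>)" by (intro sum_mono) simp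
      then have "(\<Sum>n<B. \<bar>j n\<bar>) \<le> int k" using short by linarith
      moreover have "(\<Sum>n<B. j n / real p ^ n) - \<gamma> \<in> \<int>"
        using rel l0 by simp
      ultimately have "\<gamma> \<in> \<int>"
        using short_tail_integer[OF p_ge_2, of j B k M q \<gamma>] late \<gamma>(2) by (simp add: M_def)
      then show ?thesis by (simp add: \<gamma>(1) E_eq_1_iff)
    qed
    ultimately show False using g(2) by (auto simp: prod_eq_iff)
  qed
  then show ?thesis by blast
qed

lemma null_terms_generate: "carrier G \<subseteq> (\<Union>n. prods (replicate n 0))"
proof
  let ?K = "\<Union>n. prods (replicate n 0)"
  note K = subgroup_prods
  note Kpow = subgroup_int_pow_closed[OF K]
  have A0: "x \<in> ?K" if "x \<in> A 0" for x
    using prods_ConsI[OF that, of "\<one>\<^bsub>G\<^esub>" "[]"] A_closed[OF that] 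
    by (intro UN_I[of 1]) (simp_all del: one_DirProd carrier_DirProd)
  have root: "unit_root n \<in> ?K" for n
    using A_memI[of 0 n 0 1] unit_root_closed[of n] by (intro A0) (simp del: one_DirProd carrier_DirProd)
  have word: "null_word n \<in> ?K" for n
    using A_memI[of 0 n 1 0] null_word_closed[of n] by (intro A0) (simp del: one_DirProd carrier_DirProd)
  have E: "(E x, \<one>\<^bsub>H\<^esub>) \<in> ?K" if "real p ^ n * x \<in> \<int>" for n x
    using unit_root_power[OF that] Kpow[OF root] by metis
  have block: "block n \<in> ?K" for n
    unfolding block_def by (rule E[OF block_scaled])
  have s: "s n \<in> ?K" for n
    using subgroup.m_closed[OF K word subgroup.m_inv_closed[OF K block]] s_eq[of n] by (simp only:)
  fix g assume g: "g \<in> carrier G"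
  then obtain q where "fst g ^ (p ^ q) = 1" by auto
  then obtain x where x: "fst g = E x" "real p ^ q * x \<in> \<int>"
    using root_of_unity_lift[of "fst g" "p ^ q"] p_pos by (metis of_nat_power zero_less_power)
  have "(1, snd g) \<in> H1" using g H_subset by auto
  then obtain n where "s n = (1, snd g)" using s_often[of _ 0] by blast
  then have "(E x, \<one>\<^bsub>H\<^esub>) \<otimes>\<^bsub>G\<^esub> (1, snd g) \<in> ?K"
    using subgroup.m_closed[OF K E[OF x(2)] s[of n]] by simp
  moreover have "(E x, \<one>\<^bsub>H\<^esub>) \<otimes>\<^bsub>G\<^esub> (1, snd g) = g"
    using g by (auto simp: x(1)[symmetric] mult_DirProd' prod_eq_iff)
  ultimately show "g \<in> ?K" by simp
qed

text \<open>
  The \<open>n\<close> factors of \<open>v\<^sub>n\<close> are distinct generators of index at least \<open>n\<close>, so their total distance from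
  \<open>1\<close> is bounded by a tail of a convergent series.
\<close>

lemma character_block_tendsto:
  assumes hom: "f \<in> hom G circle_group" and lim: "(\<lambda>n. f (unit_root n)) \<longlonglongrightarrow> 1"
  shows "(\<lambda>n. f (block n)) \<longlonglongrightarrow> 1"
proof (rule LIMSEQ_I)
  fix r :: real assume r: "r > 0"
  have "f (unit_root (Suc n)) ^ p = f (unit_root n)" for n
  proof -
    have "unit_root (Suc n) [^]\<^bsub>G\<^esub> int p = unit_root n"
    proof (rule prod_eqI)
      show "fst (unit_root (Suc n) [^]\<^bsub>G\<^esub> int p) = fst (unit_root n)"
        using character_int_pow[OF fst_hom unit_root_closed[of "Suc n"], of "int p"] p_pos
        by (simp add: unit_root_def E_power)
      show "snd (unit_root (Suc n) [^]\<^bsub>G\<^esub> int p) = snd (unit_root n)"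
        using snd_int_pow[OF unit_root_closed[of "Suc n"], of "int p"] by (simp add: unit_root_def)
    qed
    then show ?thesis
      using character_int_pow[OF hom unit_root_closed[of "Suc n"], of "int p"] by simp
  qed
  then have "summable (\<lambda>n. norm (f (unit_root n) - 1))"
    using summable_dist_one_of_roots[OF p_ge_2 _ lim] by blast
  then obtain N where N: "\<And>m n. m \<ge> N \<Longrightarrow> norm (\<Sum>i=m..<n. norm (f (unit_root i) - 1)) < r"
    using r unfolding summable_Cauchy by blast
  have "norm (f (block n) - 1) < r" if "n \<ge> N" for n
  proof -
    have "norm (f (block n) - 1) \<le> (\<Sum>t<n. norm (f (unit_root (n ^ 3 + (2 * t + 1) * n)) - 1))"
      unfolding block_eq_finprod using unit_root_closed by (intro character_finprod_dist hom) auto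
    also have "\<dots> = (\<Sum>i\<in>(\<lambda>t. n ^ 3 + (2 * t + 1) * n) ` {..<n}. norm (f (unit_root i) - 1))"
      by (subst sum.reindex) (auto simp: inj_on_def)
    also have "\<dots> \<le> (\<Sum>i=n..<Suc (Suc n ^ 3). norm (f (unit_root i) - 1))"
    proof (rule sum_mono2)
      show "(\<lambda>t. n ^ 3 + (2 * t + 1) * n) ` {..<n} \<subseteq> {n..<Suc (Suc n ^ 3)}"
      proof
        fix i assume "i \<in> (\<lambda>t. n ^ 3 + (2 * t + 1) * n) ` {..<n}"
        then obtain t where t: "t < n" "i = n ^ 3 + (2 * t + 1) * n" by auto
        then have "i \<le> Suc n ^ 3" using block_exponent_le[of n "Suc n" t] by simp
        then show "i \<in> {n..<Suc (Suc n ^ 3)}" using t(2) by auto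
      qed
    qed auto
    also have "\<dots> < r" using N[OF that, of "Suc (Suc n ^ 3)"] by simp
    finally show ?thesis .
  qed
  then show "\<exists>N. \<forall>n\<ge>N. norm (f (block n) - 1) < r" by blast
qed

lemma character_word: "f \<in> hom G circle_group \<Longrightarrow> f (null_word n) = f (s n) * f (block n)"
  unfolding null_word_def using H1_closed[OF s_mem] block_closed by (intro character_mult)

text \<open>
  As \<open>\<chi>(v\<^sub>n) \<longlonglongrightarrow> 1\<close>, convergence along the words means \<open>\<chi>(s\<^sub>n) \<longlonglongrightarrow> 1\<close>; since \<open>s\<close> takes every value in
  \<open>H1\<close> infinitely often, this forces \<open>\<chi> = 1\<close> on \<open>H1\<close>.
\<close>

lemma continuous_characters_iff:
  "f \<in> continuous_characters G vtop \<longleftrightarrow> 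
    f \<in> hom G circle_group \<and> (\<lambda>n. f (unit_root n)) \<longlonglongrightarrow> 1 \<and> (\<forall>h\<in>H1. f h = 1)"
proof
  assume "f \<in> continuous_characters G vtop"
  then have hom: "f \<in> hom G circle_group" and small: "\<And>\<epsilon>. \<epsilon> > 0 \<Longrightarrow> \<exists>n. \<forall>a\<in>A n. norm (f a - 1) < \<epsilon>"
    by (auto simp: continuous_characters_vtop)
  have mem: "unit_root n \<in> A m" "null_word n \<in> A m" if "n \<ge> m" for m n
    using A_memI[OF that, of 0 1] A_memI[OF that, of 1 0] unit_root_closed[of n] null_word_closed[of n] 
    by (simp_all del: one_DirProd carrier_DirProd)
  have lim: "(\<lambda>n. f (w n)) \<longlonglongrightarrow> 1" if w: "\<And>m n. m \<le> n \<Longrightarrow> w n \<in> A m" for w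
  proof (rule LIMSEQ_I)
    fix r :: real assume "r > 0"
    then obtain m where "\<forall>a\<in>A m. norm (f a - 1) < r" using small by blast
    then show "\<exists>m. \<forall>n\<ge>m. norm (f (w n) - 1) < r" using w by blast
  qed
  note lim = lim[of unit_root, OF mem(1)] lim[of null_word, OF mem(2)]
  have "(\<lambda>n. f (null_word n) / f (block n)) \<longlonglongrightarrow> 1 / 1"
    by (intro tendsto_divide lim character_block_tendsto hom) simp_all
  moreover have "f (block n) \<noteq> 0" for n
    using character_norm[OF hom block_closed[of n]] by auto
  then have "f (null_word n) / f (block n) = f (s n)" for n
    using character_word[OF hom] by simp
  ultimately have lim_s: "(\<lambda>n. f (s n)) \<longlonglongrightarrow> 1" by simp
  have "f h = 1" if h: "h \<in> H1" for h
  proof (rule ccontr)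
    assume "f h \<noteq> 1"
    then obtain N where N: "\<And>n. n \<ge> N \<Longrightarrow> norm (f (s n) - 1) < norm (f h - 1)"
      using LIMSEQ_D[OF lim_s, of "norm (f h - 1)"] by auto
    then show False using s_often[OF h, of N] by auto
  qed
  with hom lim show "f \<in> hom G circle_group \<and> (\<lambda>n. f (unit_root n)) \<longlonglongrightarrow> 1 \<and> (\<forall>h\<in>H1. f h = 1)"
    by blast
next
  assume "f \<in> hom G circle_group \<and> (\<lambda>n. f (unit_root n)) \<longlonglongrightarrow> 1 \<and> (\<forall>h\<in>H1. f h = 1)"
  then have hom: "f \<in> hom G circle_group" and root: "(\<lambda>n. f (unit_root n)) \<longlonglongrightarrow> 1" 
    and H1: "\<And>h. h \<in> H1 \<Longrightarrow> f h = 1" by auto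
  have word: "(\<lambda>n. f (null_word n)) \<longlonglongrightarrow> 1"
    using character_block_tendsto[OF hom root] character_word[OF hom] H1[OF s_mem] by simp
  have "\<exists>n. \<forall>a\<in>A n. norm (f a - 1) < \<epsilon>" if \<epsilon>: "\<epsilon> > 0" for \<epsilon>
  proof -
    obtain N1 where N1: "\<And>n. n \<ge> N1 \<Longrightarrow> norm (f (unit_root n) - 1) < \<epsilon>"
      using LIMSEQ_D[OF root \<epsilon>] by blast
    obtain N2 where N2: "\<And>n. n \<ge> N2 \<Longrightarrow> norm (f (null_word n) - 1) < \<epsilon>"
      using LIMSEQ_D[OF word \<epsilon>] by blast
    have inv: "norm (inverse (f x) - 1) = norm (f x - 1)" if "x \<in> carrier G" for x
    proof -
      have "f x \<noteq> 0" using character_norm[OF hom that] by auto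
      then have "inverse (f x) - 1 = - (f x - 1) * inverse (f x)" by (simp add: field_simps)
      then show ?thesis using character_norm[OF hom that] 
        by (simp add: norm_mult norm_inverse norm_minus_commute)
    qed
    have "norm (f a - 1) < \<epsilon>" if aA: "a \<in> A (max N1 N2)" for a
    proof -
      obtain n i j where a: "a = null_word n [^]\<^bsub>G\<^esub> i \<otimes>\<^bsub>G\<^esub> unit_root n [^]\<^bsub>G\<^esub> j" "max N1 N2 \<le> n" "\<bar>i\<bar> + \<bar>j\<bar> \<le> (1::int)"
        using aA by (auto simp: A_def)
      have fa: "f a = f (null_word n) powi i * f (unit_root n) powi j"
        using null_word_closed unit_root_closed hom 
        by (simp add: a(1) character_mult character_int_pow del: carrier_DirProd)
      consider "i = 0" "j = 0" | "i = 1" "j = 0" | "i = -1" "j = 0" | "i = 0" "j = 1" | "i = 0" "j = -1"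
        using a(3) by linarith
      then show ?thesis
        using N1[of n] N2[of n] a(2) \<epsilon> inv[OF null_word_closed[of n]] inv[OF unit_root_closed[of n]]
        by cases (simp_all add: fa power_int_minus)
    qed
    then show ?thesis by blast
  qed
  with hom show "f \<in> continuous_characters G vtop"
    by (simp add: continuous_characters_vtop)
qed

text \<open>
  Let \<open>z\<close> be the Pruefer component of \<open>g\<close>, of order \<open>p\<^sup>k\<close>. The subgroups of the Pruefer group form a
  chain, so every Pruefer component of \<open>H1\<close> has order at most \<open>p\<^bsup>k-1\<^esup>\<close>: otherwise it would generate \<open>z\<close>.
  Raising to the power \<open>p\<^bsup>k-1\<^esup>\<close> therefore kills \<open>H1\<close> but not \<open>z\<close>.
\<close>

lemma separating_character:
  assumes g: "g \<in> carrier G" "g \<notin> H1"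
  shows "\<exists>f\<in>continuous_characters G vtop. f g \<noteq> 1"
proof -
  define z where "z = fst g"
  have reduce: "(fst x, \<one>\<^bsub>H\<^esub>) \<in> H1 \<longleftrightarrow> x \<in> H1" if x: "x \<in> carrier G" for x
  proof
    have y: "(1, snd x) \<in> H1" using H_subset x by auto
    have eq: "x = (fst x, \<one>\<^bsub>H\<^esub>) \<otimes>\<^bsub>G\<^esub> (1, snd x)"
      using x by (auto simp: mult_DirProd' prod_eq_iff)
    assume "(fst x, \<one>\<^bsub>H\<^esub>) \<in> H1"
    from subgroup.m_closed[OF subgroup_H1 this y] show "x \<in> H1" using eq by simp
  next
    have y: "(1, inv\<^bsub>H\<^esub> (snd x)) \<in> H1" using H_subset x by auto
    have eq: "(fst x, \<one>\<^bsub>H\<^esub>) = x \<otimes>\<^bsub>G\<^esub> (1, inv\<^bsub>H\<^esub> (snd x))"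
      using x by (auto simp: mult_DirProd' prod_eq_iff)
    assume "x \<in> H1"
    from subgroup.m_closed[OF subgroup_H1 this y] show "(fst x, \<one>\<^bsub>H\<^esub>) \<in> H1" using eq by simp
  qed
  have z: "(z, \<one>\<^bsub>H\<^esub>) \<notin> H1" using reduce[OF g(1)] g(2) by (simp add: z_def)
  obtain q where q: "z ^ (p ^ q) = 1" using g(1) by (auto simp: z_def)
  define k where "k = (LEAST k. z ^ (p ^ k) = 1)"
  have zk: "z ^ (p ^ k) = 1" unfolding k_def by (rule LeastI[of _ q]) (rule q)
  have "z \<noteq> 1" using z H_subset by auto
  then have k: "k > 0" using zk by (cases k) auto
  have zk1: "z ^ (p ^ (k - 1)) \<noteq> 1"
    using not_less_Least[of "k - 1" "\<lambda>k. z ^ (p ^ k) = 1"] k by (auto simp: k_def)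
  define f where "f = (\<lambda>x :: complex \<times> 'a. fst x ^ (p ^ (k - 1)))"
  have hom: "f \<in> hom G circle_group"
    using character_norm[OF fst_hom] by (auto simp: hom_def f_def norm_power power_mult_distrib)
  have "f h = 1" if h: "h \<in> H1" for h
  proof (rule ccontr)
    assume fh: "f h \<noteq> 1"
    define a where "a = fst h"
    have ak: "a ^ (p ^ (k - 1)) \<noteq> 1" using fh by (simp add: f_def a_def)
    obtain r where r: "a ^ (p ^ r) = 1" using H1_closed[OF h] by (auto simp: a_def)
    define j where "j = (LEAST j. a ^ (p ^ j) = 1)"
    have aj: "a ^ (p ^ j) = 1" unfolding j_def by (rule LeastI[of _ r]) (rule r)
    have mono: "w ^ (p ^ n) = 1" if "w ^ (p ^ m) = 1" "m \<le> n" for w :: complex and m n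
    proof -
      have "p ^ n = p ^ m * p ^ (n - m)" using that(2) by (simp flip: power_add)
      then show ?thesis using that(1) by (simp add: power_mult)
    qed
    have "j \<ge> k" using mono[OF aj, of "k - 1"] ak by fastforce
    then have j: "j > 0" using k by simp
    have aj1: "a ^ (p ^ (j - 1)) \<noteq> 1"
      using not_less_Least[of "j - 1" "\<lambda>j. a ^ (p ^ j) = 1"] j by (auto simp: j_def)
    obtain i :: int where i: "z = a powi i"
      using primitive_root_generates[OF prime j aj aj1 mono[OF zk \<open>j \<ge> k\<close>]] .
    have ah: "(a, \<one>\<^bsub>H\<^esub>) \<in> H1" using reduce[OF H1_closed[OF h]] h by (simp add: a_def)
    have "(a, \<one>\<^bsub>H\<^esub>) [^]\<^bsub>G\<^esub> i \<in> H1"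
      using subgroup_int_pow_closed[OF subgroup_H1 ah] .
    moreover have "(a, \<one>\<^bsub>H\<^esub>) [^]\<^bsub>G\<^esub> i = (z, \<one>\<^bsub>H\<^esub>)"
      using character_int_pow[OF fst_hom H1_closed[OF ah], of i] snd_int_pow[OF H1_closed[OF ah], of i] i
      by (simp add: prod_eq_iff)
    ultimately show False using z by simp
  qed
  moreover have "(\<lambda>n. f (unit_root n)) \<longlonglongrightarrow> 1"
  proof -
    have "(\<lambda>n. 1 / real p ^ n) \<longlonglongrightarrow> 0"
      using LIMSEQ_inverse_realpow_zero[of "real p"] p_ge_2 by (simp add: inverse_eq_divide)
    then have "(\<lambda>n. cis (2 * pi * (1 / real p ^ n)) ^ (p ^ (k - 1))) \<longlonglongrightarrow> cis (2 * pi * 0) ^ (p ^ (k - 1))"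
      by (intro tendsto_power tendsto_cis tendsto_mult_left)
    then show ?thesis by (simp add: f_def unit_root_def E_def)
  qed
  ultimately have "f \<in> continuous_characters G vtop"
    using hom by (simp add: continuous_characters_iff)
  moreover have "f g \<noteq> 1" using zk1 by (simp add: f_def z_def)
  ultimately show ?thesis by blast
qed

lemma radical_vtop: "von_neumann_radical G vtop = H1"
proof -
  have radical: "g \<in> von_neumann_radical G vtop \<longleftrightarrow> 
      (\<forall>f\<in>continuous_characters G vtop. g \<in> carrier G \<and> f g = 1)" for g
    unfolding von_neumann_radical_def kernel_def circle_group_simps INT_iff mem_Collect_eq by (rule refl)
  have "(\<lambda>_. 1) \<in> continuous_characters G vtop"
    by (simp add: continuous_characters_iff hom_def)
  then have "g \<in> carrier G" if "g \<in> von_neumann_radical G vtop" for g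
    using that radical by blast
  then have "g \<in> H1" if "g \<in> von_neumann_radical G vtop" for g
    using that radical separating_character by blast
  moreover have "g \<in> von_neumann_radical G vtop" if "g \<in> H1" for g
    using that H1_closed by (simp add: radical continuous_characters_iff)
  ultimately show ?thesis by blast
qed

end

section \<open>Existence of the topology\<close>

lemma countable_prufer_group:
  assumes "p > 0" shows "countable (carrier (prufer_group p))"
proof -
  have "carrier (prufer_group p) = (\<Union>n. {z. z ^ (p ^ n) = 1})"
    by (auto simp: prufer_group_def)
  moreover have "finite {z::complex. z ^ (p ^ n) = 1}" for n
    using assms finite_roots_unity[of "p ^ n"] by (simp add: Suc_le_eq)
  ultimately show ?thesis by (simp add: countable_finite)
qed

text \<open>
  Decoding \<open>n\<close> as a pair and keeping the first component repeats every element infinitely often;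
  \<open>x0\<close> replaces the values that come too early for the condition \<open>P\<close>.
\<close>

lemma recurrent_enumeration:
  fixes X :: "'c set" and P :: "nat \<Rightarrow> 'c \<Rightarrow> bool"
  assumes "countable X" "x0 \<in> X" "\<And>n. P n x0" "\<And>x. x \<in> X \<Longrightarrow> \<exists>N. \<forall>n\<ge>N. P n x"
  obtains s where "\<And>n. s n \<in> X" "\<And>n. P n (s n)" "\<And>x N. x \<in> X \<Longrightarrow> \<exists>n\<ge>N. s n = x"
proof -
  define t where "t = (\<lambda>n. from_nat_into X (fst (prod_decode n)))"
  define s where "s = (\<lambda>n. if P n (t n) then t n else x0)"
  have X: "X \<noteq> {}" using assms(2) by blast
  show thesis
  proof
    show "s n \<in> X" for n using from_nat_into[OF X] assms(2) by (simp add: s_def t_def)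
    show "P n (s n)" for n using assms(3) by (simp add: s_def)
    fix x N assume x: "x \<in> X"
    obtain M where M: "\<And>n. n \<ge> M \<Longrightarrow> P n x" using assms(4)[OF x] by blast
    obtain i where i: "from_nat_into X i = x" using from_nat_into_surj[OF assms(1) x] by blast
    define n where "n = prod_encode (i, max M N)"
    have "n \<ge> max M N" unfolding n_def by (rule le_prod_encode_2)
    moreover have "t n = x" by (simp add: t_def n_def i)
    ultimately show "\<exists>n\<ge>N. s n = x" using M[of n] by (intro exI[of _ n]) (simp add: s_def)
  qed
qed

theorem proposition2:
  fixes p :: nat and H :: "('a, 'b) monoid_scheme" and H1 :: "(complex \<times> 'a) set"
  assumes "prime p"
    and "comm_group H"
    and "countable (carrier H)"
    and "subgroup H1 (prufer_group p \<times>\<times> H)"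
    and "{\<one>\<^bsub>prufer_group p\<^esub>} \<times> carrier H \<subseteq> H1"
  shows "\<exists>T. complete_group_topology (prufer_group p \<times>\<times> H) T \<and> Hausdorff_space T \<and>
           von_neumann_radical (prufer_group p \<times>\<times> H) T = H1"
proof -
  have p: "p > 0" using assms(1) by (rule prime_gt_0_nat)
  have sub: "H1 \<subseteq> carrier (prufer_group p) \<times> carrier H"
    using subgroup.subset[OF assms(4)] by simp
  then have countable: "countable H1"
    using countable_prufer_group[OF p] assms(3) by (meson countable_SIGMA countable_subset)
  have one: "(1, \<one>\<^bsub>H\<^esub>) \<in> H1"
    using subgroup.one_closed[OF assms(4)] by simp
  have order: "\<exists>N. \<forall>n\<ge>N. fst h ^ (p ^ n) = 1" if "h \<in> H1" for h
  proof -
    have "fst h \<in> carrier (prufer_group p)" using that sub by auto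
    then obtain N where N: "fst h ^ (p ^ N) = 1" by auto
    have "fst h ^ (p ^ n) = 1" if "n \<ge> N" for n
    proof -
      have "p ^ n = p ^ N * p ^ (n - N)" using that by (simp flip: power_add)
      then show ?thesis using N by (simp add: power_mult)
    qed
    then show ?thesis by blast
  qed
  obtain s where s: "\<And>n. s n \<in> H1" "\<And>n. fst (s n) ^ (p ^ n) = 1" 
      "\<And>h N. h \<in> H1 \<Longrightarrow> \<exists>n\<ge>N. s n = h"
    by (rule recurrent_enumeration[OF countable one, of "\<lambda>n h. fst h ^ (p ^ n) = 1"]) (use order in auto)
  interpret prufer_sum p H H1 s
    by (rule prufer_sum.intro) (use assms s in simp_all)
  show ?thesis
    using complete_vtop[OF null_terms_generate] Hausdorff_vtop[OF not_in_some_power] radical_vtop by blast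
qed

end
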